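(* Let $\mathcal{H}_1,\mathcal{H}_2$ be complex separable Hilbert spaces and let $A:\operatorname{dom}(A)\subseteq\mathcal{H}_1\to\mathcal{H}_2$ be a densely defined, closed, linear operator with $\ker(A)=\{0\}$ and $\inf(\sigma(A^*A))=0$. Then $$Q_{A,0}\,[I_{\mathcal{H}_1\oplus\mathcal{H}_2}-P_{\ker(Q_{A,0})}]=U_{\widetilde A}\,i\,G_{A,0}\,U_{\widetilde A}^{-1},$$ where the left-hand side is regarded as an operator in $\mathcal{H}_1\oplus\mathcal{K}_A$ (equality including domains). In particular, the operator $i\,G_{A,0}$ is self-adjoint in $\mathcal{H}_A\oplus\mathcal{H}_1$, and hence $G_{A,0}$ generates a unitary group $e^{G_{A,0}t}$, $t\in\mathbb{R}$, in $\mathcal{H}_A\oplus\mathcal{H}_1$. Moreover, $G_{A,0}$ is unitarily equivalent to $-G_{A,0}$.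
   Context: $P_{\mathcal{M}}$ denotes the orthogonal projection onto a closed subspace $\mathcal{M}$. Under the hypotheses on $A$: - $\mathcal{H}_A$ is the Hilbert space completion of $\operatorname{dom}(A)$ with respect to the scalar product $(f,g)_A=(Af,Ag)_{\mathcal{H}_2}$; $\operatorname{dom}(A)$ is regarded as a dense subspace of $\mathcal{H}_A$. - $\mathcal{K}_A=\overline{\operatorname{ran}(A)}=\ker(A^* )^\perp\subseteq\mathcal{H}_2$. - $\widetilde A:\mathcal{H}_A\to\mathcal{K}_A$ is the unique unitary extension of the isometric map $\mathcal{H}_A\supseteq\operatorname{dom}(A)\to\mathcal{K}_A$, $f\mapsto Af$. - $J_A:\mathcal{H}_1\supseteq\operatorname{dom}(A)\to\mathcal{H}_A$, $f\mapsto f$ (an in general unbounded operator from $\mathcal{H}_1$ to $\mathcal{H}_A$). - $U_{\widetilde A}=\begin{pmatrix}0&I_{\mathcal{H}_1}\\-i\widetilde A&0\end{pmatrix}:\mathcal{H}_A\oplus\mathcal{H}_1\to\mathcal{H}_1\oplus\mathcal{K}_A$, a unitary operator. - $G_{A,0}=\begin{pmatrix}0&J_A\\-A^*\widetilde A&0\end{pmatrix}$ in $\mathcal{H}_A\oplus\mathcal{H}_1$ with $\operatorname{dom}(G_{A,0})=\operatorname{dom}(A^*\widetilde A)\oplus\operatorname{dom}(A)$, where $\operatorname{dom}(A^*\widetilde A)=\{f\in\mathcal{H}_A : \widetilde Af\in\operatorname{dom}(A^* )\}$. - $Q_{A,0}=\begin{pmatrix}0&A^*\\ A&0\end{pmatrix}$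 in $\mathcal{H}_1\oplus\mathcal{H}_2$ with $\operatorname{dom}(Q_{A,0})=\operatorname{dom}(A)\oplus\operatorname{dom}(A^* )$; it is self-adjoint, and $\ker(Q_{A,0})=\{0\}\oplus\ker(A^* )$. The subspace $\mathcal{H}_1\oplus\mathcal{K}_A=\ker(Q_{A,0})^\perp$ reduces $Q_{A,0}$; the operator $Q_{A,0}[I-P_{\ker(Q_{A,0})}]$ regarded in $\mathcal{H}_1\oplus\mathcal{K}_A$ is the part of $Q_{A,0}$ there, i.e. $(f,g)\mapsto(A^*g,Af)$ on $\operatorname{dom}(A)\oplus(\operatorname{dom}(A^* )\cap\mathcal{K}_A)$. *)

theory Defs
  imports "HOL-Analysis.Analysis"
begin

section \<open>Complex Hilbert spaces\<close>

text \<open>The scalar product is linear in the second argument. Positive definiteness is contained in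
  \<open>cinner_self\<close>, which also ties the norm of the underlying real normed space to the scalar
  product.\<close>

class complex_inner = real_normed_vector +
  fixes scaleC :: "complex \<Rightarrow> 'a \<Rightarrow> 'a" (infixr "*\<^sub>C" 75)
    and cinner :: "'a \<Rightarrow> 'a \<Rightarrow> complex"
  assumes scaleC_add_right: "c *\<^sub>C (x + y) = c *\<^sub>C x + c *\<^sub>C y"
    and scaleC_add_left: "(c + d) *\<^sub>C x = c *\<^sub>C x + d *\<^sub>C x"
    and scaleC_scaleC: "c *\<^sub>C d *\<^sub>C x = (c * d) *\<^sub>C x"
    and scaleR_scaleC: "scaleR r x = complex_of_real r *\<^sub>C x"
    and cinner_commute: "cinner x y = cnj (cinner y x)"
    and cinner_add_right: "cinner x (y + z) = cinner x y + cinner x z"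
    and cinner_scaleC_right: "cinner x (c *\<^sub>C y) = c * cinner x y"
    and cinner_self: "cinner x x = complex_of_real ((norm x)\<^sup>2)"

class chilbert_space = complex_inner + complete_space

lemma scaleC_one: "1 *\<^sub>C x = (x :: 'a :: complex_inner)"
  using scaleR_scaleC[of 1 x] by simp

lemma vector_space_scaleC: "vector_space (scaleC :: complex \<Rightarrow> 'a \<Rightarrow> 'a :: complex_inner)"
  by unfold_locales (simp_all add: scaleC_add_right scaleC_add_left scaleC_scaleC scaleC_one)

text \<open>The orthogonal sum of two spaces is the product type; its norm is the library's Euclidean
  product norm.\<close>

instantiation prod :: (complex_inner, complex_inner) complex_inner
begin

definition scaleC_prod_def: "c *\<^sub>C p = (c *\<^sub>C fst p, c *\<^sub>C snd p)"

definition cinner_prod_def: "cinner p q = cinner (fst p) (fst q) + cinner (snd p) (snd q)"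

instance
proof
  fix c d :: complex and r :: real and x y z :: "'a \<times> 'b"
  show "c *\<^sub>C (x + y) = c *\<^sub>C x + c *\<^sub>C y"
    by (simp add: scaleC_prod_def scaleC_add_right)
  show "(c + d) *\<^sub>C x = c *\<^sub>C x + d *\<^sub>C x"
    by (simp add: scaleC_prod_def scaleC_add_left)
  show "c *\<^sub>C d *\<^sub>C x = (c * d) *\<^sub>C x"
    by (simp add: scaleC_prod_def scaleC_scaleC)
  show "scaleR r x = complex_of_real r *\<^sub>C x"
    by (simp add: scaleC_prod_def scaleR_prod_def scaleR_scaleC)
  show "cinner x y = cnj (cinner y x)"
    using cinner_commute[of "fst x" "fst y"] cinner_commute[of "snd x" "snd y"]
    by (simp add: cinner_prod_def)
  show "cinner x (y + z) = cinner x y + cinner x z"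
    by (simp add: cinner_prod_def cinner_add_right)
  show "cinner x (c *\<^sub>C y) = c * cinner x y"
    by (simp add: cinner_prod_def scaleC_prod_def cinner_scaleC_right distrib_left)
  show "cinner x x = complex_of_real ((norm x)\<^sup>2)"
    by (simp add: cinner_prod_def cinner_self norm_prod_def)
qed

end

instance prod :: (chilbert_space, chilbert_space) chilbert_space ..


section \<open>Unbounded operators\<close>

text \<open>An operator is identified with its graph, so equality of graphs is equality of operators
  including domains. The domain and range are \<^const>\<open>Domain\<close> and \<^const>\<open>Range\<close>, the inverse of an
  injective operator is its \<^const>\<open>converse\<close>, and an operator is closed iff its graph is closed in the
  product topology.\<close>

type_synonym ('a, 'b) operator = "('a \<times> 'b) set"

definition linear_operator :: "('a::complex_inner, 'b::complex_inner) operator \<Rightarrow> bool" where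
  "linear_operator T \<longleftrightarrow> module.subspace scaleC T \<and> single_valued T"

definition densely_defined :: "('a::complex_inner, 'b::complex_inner) operator \<Rightarrow> bool" where
  "densely_defined T \<longleftrightarrow> closure (Domain T) = UNIV"

definition ker :: "('a::complex_inner, 'b::complex_inner) operator \<Rightarrow> 'a set" where
  "ker T = {f. (f, 0) \<in> T}"

definition adjoint_op ::
  "('a::complex_inner, 'b::complex_inner) operator \<Rightarrow> ('b, 'a) operator" where
  "adjoint_op T = {(g, h). \<forall>(f, k)\<in>T. cinner k g = cinner f h}"

definition self_adjoint :: "('a::complex_inner, 'a) operator \<Rightarrow> bool" where
  "self_adjoint T \<longleftrightarrow> linear_operator T \<and> densely_defined T \<and> adjoint_op T = T"

text \<open>Composition in operator order (\<open>T\<close> is applied first), with the natural domain.\<close>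

abbreviation op_comp :: "('b, 'c) operator \<Rightarrow> ('a, 'b) operator \<Rightarrow> ('a, 'c) operator"
    (infixr "\<circ>\<^sub>o" 75) where
  "S \<circ>\<^sub>o T \<equiv> T O S"

definition fun_op :: "('a \<Rightarrow> 'b) \<Rightarrow> ('a, 'b) operator" where
  "fun_op f = {(x, f x) | x. True}"

definition scale_op :: "complex \<Rightarrow> ('a, 'b::complex_inner) operator \<Rightarrow> ('a, 'b) operator" where
  "scale_op c T = {(f, c *\<^sub>C g) | f g. (f, g) \<in> T}"

text \<open>The operator \<open>T\<close> regarded as an operator in the subspace \<open>M\<close>.\<close>

definition part_in :: "'a set \<Rightarrow> ('a, 'a) operator \<Rightarrow> ('a, 'a) operator" where
  "part_in M T = T \<inter> (M \<times> M)"

definition resolvent_set :: "('a::complex_inner, 'a) operator \<Rightarrow> complex set" where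
  "resolvent_set T =
     {z. let R = {(g - z *\<^sub>C f, f) | f g. (f, g) \<in> T} in
         single_valued R \<and> Domain R = UNIV \<and> (\<exists>C. \<forall>(g, f)\<in>R. norm f \<le> C * norm g)}"

definition spectrum :: "('a::complex_inner, 'a) operator \<Rightarrow> complex set" where
  "spectrum T = - resolvent_set T"

text \<open>Bottom of the spectrum of an operator with real spectrum. It is taken in the extended reals, so
  that an empty spectrum has bottom \<open>\<infinity>\<close>.\<close>

definition inf_spectrum :: "('a::complex_inner, 'a) operator \<Rightarrow> ereal" where
  "inf_spectrum T = (INF z\<in>spectrum T. ereal (Re z))"

definition orth_proj :: "'a::complex_inner set \<Rightarrow> 'a \<Rightarrow> 'a" where
  "orth_proj M x = (THE y. y \<in> M \<and> (\<forall>z\<in>M. cinner z (x - y) = 0))"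

definition unitary_onto :: "('a::complex_inner \<Rightarrow> 'b::complex_inner) \<Rightarrow> 'b set \<Rightarrow> bool" where
  "unitary_onto V N \<longleftrightarrow> Vector_Spaces.linear scaleC scaleC V \<and>
     (\<forall>x y. cinner (V x) (V y) = cinner x y) \<and> range V = N"

definition unitarily_equivalent ::
  "('a::complex_inner, 'a) operator \<Rightarrow> ('b::complex_inner, 'b) operator \<Rightarrow> bool" where
  "unitarily_equivalent S T \<longleftrightarrow>
     (\<exists>V. unitary_onto V UNIV \<and> T = fun_op V \<circ>\<^sub>o S \<circ>\<^sub>o (fun_op V)\<inverse>)"

definition unitary_group :: "(real \<Rightarrow> 'a::complex_inner \<Rightarrow> 'a) \<Rightarrow> bool" where
  "unitary_group W \<longleftrightarrow> (\<forall>t. unitary_onto (W t) UNIV) \<and> W 0 = id \<and>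
     (\<forall>s t. W (s + t) = W s \<circ> W t) \<and> (\<forall>x. continuous_on UNIV (\<lambda>t. W t x))"

definition generator :: "(real \<Rightarrow> 'a::complex_inner \<Rightarrow> 'a) \<Rightarrow> ('a, 'a) operator" where
  "generator W = {(x, y). ((\<lambda>t. W t x) has_vector_derivative y) (at 0)}"

text \<open>A strongly continuous group is determined by its generator; the group \<open>W\<close> below is \<open>exp (t T)\<close>.\<close>

definition generates_unitary_group :: "('a::complex_inner, 'a) operator \<Rightarrow> bool" where
  "generates_unitary_group T \<longleftrightarrow> (\<exists>W. unitary_group W \<and> generator W = T)"


section \<open>The operators attached to \<open>A\<close>\<close>

text \<open>The type \<open>'h\<close> together with the embedding \<open>e\<close> of \<open>dom(A)\<close> is a completion of \<open>dom(A)\<close> with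
  respect to the scalar product \<open>(f, g) \<mapsto> (Af, Ag)\<close>. Values of \<open>e\<close> outside \<open>dom(A)\<close> are irrelevant.
  Completeness of \<open>'h\<close> is part of its sort.\<close>

definition energy_completion ::
  "('a::complex_inner, 'b::complex_inner) operator \<Rightarrow> ('a \<Rightarrow> 'h::chilbert_space) \<Rightarrow> bool" where
  "energy_completion A e \<longleftrightarrow>
     (\<forall>f\<in>Domain A. \<forall>g\<in>Domain A. e (f + g) = e f + e g) \<and>
     (\<forall>c. \<forall>f\<in>Domain A. e (c *\<^sub>C f) = c *\<^sub>C e f) \<and>
     (\<forall>(f, u)\<in>A. \<forall>(g, v)\<in>A. cinner (e f) (e g) = cinner u v) \<and>
     closure (e ` Domain A) = UNIV"

definition K_space :: "('a::complex_inner, 'b::complex_inner) operator \<Rightarrow> 'b set" where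
  "K_space A = closure (Range A)"

definition A_tilde ::
  "('a::complex_inner, 'b::complex_inner) operator \<Rightarrow> ('a \<Rightarrow> 'h::chilbert_space) \<Rightarrow> 'h \<Rightarrow> 'b" where
  "A_tilde A e = (THE V. unitary_onto V (K_space A) \<and> (\<forall>(f, u)\<in>A. V (e f) = u))"

definition J_op ::
  "('a::complex_inner, 'b::complex_inner) operator \<Rightarrow> ('a \<Rightarrow> 'h::chilbert_space)
   \<Rightarrow> ('a, 'h) operator" where
  "J_op A e = {(f, e f) | f. f \<in> Domain A}"

text \<open>As a map into \<open>'a \<times> 'b\<close>, its range being \<open>UNIV \<times> K_space A\<close>.\<close>

definition U_tilde ::
  "('a::complex_inner, 'b::complex_inner) operator \<Rightarrow> ('a \<Rightarrow> 'h::chilbert_space)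
   \<Rightarrow> 'h \<times> 'a \<Rightarrow> 'a \<times> 'b" where
  "U_tilde A e = (\<lambda>(h, f). (f, - (\<i> *\<^sub>C A_tilde A e h)))"

definition G_op ::
  "('a::complex_inner, 'b::complex_inner) operator \<Rightarrow> ('a \<Rightarrow> 'h::chilbert_space)
   \<Rightarrow> ('h \<times> 'a, 'h \<times> 'a) operator" where
  "G_op A e = {((h, f), (u, - k)) | h f u k.
     (f, u) \<in> J_op A e \<and> (h, k) \<in> adjoint_op A \<circ>\<^sub>o fun_op (A_tilde A e)}"

definition Q_op ::
  "('a::complex_inner, 'b::complex_inner) operator \<Rightarrow> ('a \<times> 'b, 'a \<times> 'b) operator" where
  "Q_op A = {((f, g), (k, u)) | f g k u. (f, u) \<in> A \<and> (g, k) \<in> adjoint_op A}"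

end

theory Submission
  imports Defs
begin

text \<open>Since \<open>A\<close> is closed, it is its own biadjoint, and \<open>dom(A\<^sup>*)\<close> splits along
  \<open>K_space A\<close> and \<open>ker(A\<^sup>*)\<close>; hence \<open>G\<close> satisfies \<open>G\<^sup>* = - G\<close> directly from the definition of the
  adjoint. Stone's theorem is obtained for any \<open>B\<close> with \<open>B\<^sup>* = - B\<close>: projecting onto the graph of \<open>B\<close>
  shows that \<open>r - B\<close> is onto for real \<open>r \<noteq> 0\<close>, the resolvents yield bounded skew-symmetric
  operators converging to \<open>B\<close> on its domain, and the exponentials of these converge locally uniformly
  to the unitary group. The intertwining identity with \<open>Q\<close> is a computation with graphs, as the
  projection onto \<open>ker(Q)\<close> vanishes on \<open>UNIV \<times> K_space A\<close>, and
  \<open>(h, f) \<mapsto> (h, - f)\<close> conjugates \<open>G\<close> into \<open>- G\<close>.\<close>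

section \<open>Scalar products\<close>

instance chilbert_space \<subseteq> banach ..

interpretation complex_vector: vector_space "scaleC :: complex \<Rightarrow> 'a \<Rightarrow> 'a::complex_inner"
  by (rule vector_space_scaleC)

lemma cinner_add_left: "cinner (x + y) z = cinner x z + cinner y z"
  by (metis cinner_add_right cinner_commute complex_cnj_add)

lemma cinner_scaleC_left: "cinner (c *\<^sub>C x) y = cnj c * cinner x y"
  by (metis cinner_scaleC_right cinner_commute complex_cnj_mult)

lemma cinner_scaleR_left: "cinner (r *\<^sub>R x) y = r *\<^sub>R cinner x y"
  by (simp add: scaleR_scaleC cinner_scaleC_left scaleR_conv_of_real)

lemma cinner_scaleR_right: "cinner x (r *\<^sub>R y) = r *\<^sub>R cinner x y"
  by (simp add: scaleR_scaleC cinner_scaleC_right scaleR_conv_of_real)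

lemma cinner_zero_left [simp]: "cinner 0 x = 0"
  using cinner_add_left[of 0 0 x] by simp

lemma cinner_zero_right [simp]: "cinner x 0 = 0"
  using cinner_add_right[of x 0 0] by simp

lemma cinner_minus_left [simp]: "cinner (- x) y = - cinner x y"
  using cinner_scaleR_left[of "-1" x y] by simp

lemma cinner_minus_right [simp]: "cinner x (- y) = - cinner x y"
  using cinner_scaleR_right[of x "-1" y] by simp

lemma cinner_diff_left: "cinner (x - y) z = cinner x z - cinner y z"
  using cinner_add_left[of x "- y" z] by simp

lemma cinner_diff_right: "cinner x (y - z) = cinner x y - cinner x z"
  using cinner_add_right[of x y "- z"] by simp

lemmas cinner_simps = cinner_add_left cinner_add_right cinner_diff_left cinner_diff_right
  cinner_scaleC_left cinner_scaleC_right cinner_scaleR_left cinner_scaleR_right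

lemma norm_sq_cinner: "(norm x)\<^sup>2 = Re (cinner x x)"
  by (simp add: cinner_self)

lemma cinner_self_eq_0: "cinner x x = 0 \<longleftrightarrow> x = 0"
  by (simp add: cinner_self)

lemma norm_scaleC: "norm (c *\<^sub>C x) = cmod c * norm x"
proof -
  have "cinner (c *\<^sub>C x) (c *\<^sub>C x) = c * cnj c * of_real ((norm x)\<^sup>2)"
    by (subst cinner_scaleC_left, subst cinner_scaleC_right) (simp only: cinner_self mult_ac)
  also have "\<dots> = of_real ((cmod c * norm x)\<^sup>2)"
    by (simp only: power_mult_distrib of_real_mult complex_norm_square)
  finally have "(norm (c *\<^sub>C x))\<^sup>2 = (cmod c * norm x)\<^sup>2"
    unfolding cinner_self of_real_eq_iff .
  then show ?thesis
    by (simp add: power2_eq_iff_nonneg)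
qed

lemma norm_add_sq:
  "(norm (x + y))\<^sup>2 = (norm x)\<^sup>2 + 2 * Re (cinner x y) + (norm y)\<^sup>2"
  using cinner_commute[of x y] by (simp add: norm_sq_cinner cinner_simps)

lemma norm_diff_sq:
  "(norm (x - y))\<^sup>2 = (norm x)\<^sup>2 - 2 * Re (cinner x y) + (norm y)\<^sup>2"
  using norm_add_sq[of x "- y"] by simp

lemma parallelogram_law:
  "(norm (x + y))\<^sup>2 + (norm (x - y))\<^sup>2 = 2 * (norm x)\<^sup>2 + 2 * (norm (y::'a::complex_inner))\<^sup>2"
  by (simp add: norm_add_sq norm_diff_sq)

text \<open>Pythagoras for the component of \<open>y\<close> along \<open>z\<close>; the coefficient
  has \<open>z\<close> first because the scalar product is linear in the second argument. Its
  nonnegative left side yields \<open>Cauchy_Schwarz\<close>.\<close>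

lemma norm_diff_component_sq:
  assumes "z \<noteq> 0"
  shows "(norm (y - (cinner z y / of_real ((norm z)\<^sup>2)) *\<^sub>C z))\<^sup>2
    = (norm y)\<^sup>2 - (cmod (cinner z y))\<^sup>2 / (norm z)\<^sup>2"
proof -
  define c where "c = cinner z y / of_real ((norm z)\<^sup>2)"
  have "cinner y (c *\<^sub>C z) = cinner z y * cnj (cinner z y) / of_real ((norm z)\<^sup>2)"
    by (simp add: c_def cinner_scaleC_right cinner_commute[of y z])
  also have "\<dots> = of_real ((cmod (cinner z y))\<^sup>2 / (norm z)\<^sup>2)"
    by (simp only: of_real_divide complex_norm_square)
  finally have "Re (cinner y (c *\<^sub>C z)) = (cmod (cinner z y))\<^sup>2 / (norm z)\<^sup>2"
    by simp
  moreover have "(norm (c *\<^sub>C z))\<^sup>2 = (cmod (cinner z y))\<^sup>2 / (norm z)\<^sup>2"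
    using assms by (simp add: c_def norm_scaleC norm_divide norm_mult power_mult_distrib field_simps
        power2_eq_square)
  ultimately show ?thesis
    unfolding c_def[symmetric] norm_diff_sq by simp
qed

text \<open>Subtracting the component of \<open>y\<close> along \<open>z\<close> lowers the squared
  norm by a multiple of the squared modulus of \<open>cinner z y\<close>, which minimality forbids
  unless this is zero.\<close>

lemma cinner_eq_0_if_minimal:
  assumes min: "\<And>c. norm y \<le> norm (y - c *\<^sub>C z)"
  shows "cinner z y = 0"
proof (cases "z = 0")
  case False
  have "(norm y)\<^sup>2 \<le> (norm (y - (cinner z y / of_real ((norm z)\<^sup>2)) *\<^sub>C z))\<^sup>2"
    by (intro power_mono min norm_ge_zero)
  then show ?thesis
    unfolding norm_diff_component_sq[OF False] using False by (simp add: divide_le_0_iff)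
qed simp

lemma Cauchy_Schwarz: "cmod (cinner x y) \<le> norm x * norm y"
proof (cases "x = 0")
  case False
  have "(cmod (cinner x y))\<^sup>2 / (norm x)\<^sup>2 \<le> (norm y)\<^sup>2"
    using norm_diff_component_sq[OF False, of y] by (smt (verit) zero_le_power2)
  then have "(cmod (cinner x y))\<^sup>2 \<le> (norm x * norm y)\<^sup>2"
    using False by (simp add: field_simps)
  then show ?thesis
    by (rule power2_le_imp_le) simp
qed simp

text \<open>Conjugate linearity in the first argument is still real linearity, so limits, continuity
  and the product rule for scalar products become available.\<close>

interpretation cinner: bounded_bilinear "cinner :: 'a \<Rightarrow> 'a \<Rightarrow> complex"
  for dummy :: "'a::complex_inner itself"
  by unfold_locales
    (auto simp: cinner_simps intro!: exI[of _ 1] Cauchy_Schwarz)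

lemma bounded_linear_scaleC: "bounded_linear (\<lambda>x::'a::complex_inner. c *\<^sub>C x)"
  by (rule bounded_linear_intro[of _ "cmod c"])
    (auto simp: scaleC_add_right scaleR_scaleC scaleC_scaleC mult.commute norm_scaleC)

section \<open>Closed subspaces and orthogonality\<close>

lemma closure_complex_subspace:
  assumes "complex_vector.subspace S"
  shows "complex_vector.subspace (closure S)"
proof (rule complex_vector.subspaceI)
  show "0 \<in> closure S"
    using assms closure_subset complex_vector.subspace_0 by blast
next
  fix x y assume "x \<in> closure S" "y \<in> closure S"
  then obtain f g where "\<And>n. f n \<in> S" "f \<longlonglongrightarrow> x" "\<And>n. g n \<in> S" "g \<longlonglongrightarrow> y"
    by (auto simp: closure_sequential)
  then show "x + y \<in> closure S"
    unfolding closure_sequential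
    by (intro exI[of _ "\<lambda>n. f n + g n"])
      (auto intro: tendsto_add complex_vector.subspace_add[OF assms])
next
  fix c x assume "x \<in> closure S"
  then obtain f where "\<And>n. f n \<in> S" "f \<longlonglongrightarrow> x"
    by (auto simp: closure_sequential)
  then show "c *\<^sub>C x \<in> closure S"
    unfolding closure_sequential
    by (intro exI[of _ "\<lambda>n. c *\<^sub>C f n"])
      (auto intro: bounded_linear.tendsto[OF bounded_linear_scaleC]
        complex_vector.subspace_scale[OF assms])
qed

lemma cinner_eq_0_on_closure:
  assumes "\<And>x. x \<in> S \<Longrightarrow> cinner x y = 0" and "x \<in> closure S"
  shows "cinner x y = 0"
  using assms(2)
proof (rule continuous_constant_on_closure[rotated 2])
  show "continuous_on (closure S) (\<lambda>x. cinner x y)"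
    by (intro cinner.continuous_on continuous_intros)
qed (use assms(1) in auto)

text \<open>A minimizing sequence for the distance to the subspace is Cauchy by the parallelogram law.\<close>

theorem orthogonal_decomposition:
  fixes M :: "'a::chilbert_space set"
  assumes M: "complex_vector.subspace M" and cl: "closed M"
  obtains m where "m \<in> M" "\<And>z. z \<in> M \<Longrightarrow> cinner z (x - m) = 0"
proof -
  define d where "d = infdist x M"
  have ne: "M \<noteq> {}"
    using M complex_vector.subspace_0 by blast
  have le: "d \<le> norm (x - m)" if "m \<in> M" for m
    using infdist_le[OF that, of x] by (simp add: d_def dist_norm)
  have d0: "d \<ge> 0"
    by (simp add: d_def infdist_nonneg)
  have "\<exists>m\<in>M. norm (x - m) < d + 1 / real (Suc n)" for n
  proof (rule ccontr)
    assume "\<not> ?thesis"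
    then have "d + 1 / real (Suc n) \<le> infdist x M"
      unfolding infdist_notempty[OF ne]
      by (intro cINF_greatest[OF ne]) (auto simp: dist_norm not_less)
    then show False
      by (simp add: d_def)
  qed
  then obtain m where mM: "\<And>n. m n \<in> M" and mlt: "\<And>n. norm (x - m n) < d + 1 / real (Suc n)"
    by metis
  have lim: "(\<lambda>n. norm (x - m n)) \<longlonglongrightarrow> d"
  proof (rule tendsto_sandwich[of "\<lambda>_. d" _ _ "\<lambda>n. d + 1 / real (Suc n)"])
    show "(\<lambda>n. d + 1 / real (Suc n)) \<longlonglongrightarrow> d"
      using LIMSEQ_inverse_real_of_nat_add[of d] by (simp add: inverse_eq_divide)
  qed (use le mM mlt in \<open>auto intro!: always_eventually less_imp_le\<close>)
  have par: "(dist (m i) (m j))\<^sup>2 \<le> 2 * ((norm (x - m i))\<^sup>2 - d\<^sup>2) + 2 * ((norm (x - m j))\<^sup>2 - d\<^sup>2)"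
    for i j
  proof -
    \<comment> \<open>The midpoint of two members is a competitor for the distance, which bounds the
      sum in the parallelogram law from below by \<open>2 * d\<close>.\<close>
    have "(1/2) *\<^sub>R (m i + m j) \<in> M"
      unfolding scaleR_scaleC
      by (intro complex_vector.subspace_scale[OF M] complex_vector.subspace_add[OF M] mM)
    from le[OF this] have "d \<le> norm ((1/2) *\<^sub>R ((x - m i) + (x - m j)))"
      by (simp add: algebra_simps flip: scaleR_2 scaleR_add_left)
    then have "2 * d \<le> norm ((x - m i) + (x - m j))"
      by simp
    then have "(2 * d)\<^sup>2 \<le> (norm ((x - m i) + (x - m j)))\<^sup>2"
      using d0 by (intro power_mono) auto
    moreover have "(norm ((x - m i) - (x - m j)))\<^sup>2 = (dist (m i) (m j))\<^sup>2"
      by (simp add: dist_norm norm_minus_commute)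
    ultimately show ?thesis
      using parallelogram_law[of "x - m i" "x - m j"] by (simp add: power_mult_distrib)
  qed
  have "Cauchy m"
  proof (rule metric_CauchyI)
    fix \<epsilon> :: real assume \<epsilon>: "\<epsilon> > 0"
    have "(\<lambda>n. (norm (x - m n))\<^sup>2 - d\<^sup>2) \<longlonglongrightarrow> d\<^sup>2 - d\<^sup>2"
      by (intro tendsto_intros lim)
    then have "\<forall>\<^sub>F n in sequentially. (norm (x - m n))\<^sup>2 - d\<^sup>2 < \<epsilon>\<^sup>2 / 4"
      using \<epsilon> by (intro order_tendstoD(2)) auto
    then obtain N where N: "\<And>n. n \<ge> N \<Longrightarrow> (norm (x - m n))\<^sup>2 - d\<^sup>2 < \<epsilon>\<^sup>2 / 4"
      by (auto simp: eventually_sequentially)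
    have "dist (m i) (m j) < \<epsilon>" if "i \<ge> N" "j \<ge> N" for i j
    proof (rule power2_less_imp_less)
      show "(dist (m i) (m j))\<^sup>2 < \<epsilon>\<^sup>2"
        using par[of i j] N[OF that(1)] N[OF that(2)] by simp
    qed (use \<epsilon> in simp)
    then show "\<exists>N. \<forall>i\<ge>N. \<forall>j\<ge>N. dist (m i) (m j) < \<epsilon>"
      by blast
  qed
  then obtain l where l: "m \<longlonglongrightarrow> l"
    using Cauchy_convergent_iff convergent_def by blast
  have lM: "l \<in> M"
    using closed_sequentially[OF cl] mM l by blast
  have "norm (x - l) = d"
    using LIMSEQ_unique[OF lim tendsto_norm[OF tendsto_diff[OF tendsto_const l]]] by simp
  then have "norm (x - l) \<le> norm ((x - l) - c *\<^sub>C z)" if "z \<in> M" for c z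
    using le[of "l + c *\<^sub>C z"] that lM M
    by (simp add: algebra_simps complex_vector.subspace_add complex_vector.subspace_scale)
  then show ?thesis
    using that[OF lM] cinner_eq_0_if_minimal by metis
qed

text \<open>The residual of the projection onto \<open>closure D\<close> is orthogonal to
  \<open>D\<close>, hence zero.\<close>

lemma dense_subspace_if_orth_0:
  fixes D :: "'a::chilbert_space set"
  assumes D: "complex_vector.subspace D" and orth: "\<And>y. (\<And>x. x \<in> D \<Longrightarrow> cinner x y = 0) \<Longrightarrow> y = 0"
  shows "closure D = UNIV"
proof -
  have "x \<in> closure D" for x
  proof -
    obtain m where m: "m \<in> closure D" "\<And>z. z \<in> closure D \<Longrightarrow> cinner z (x - m) = 0"
      using orthogonal_decomposition[OF closure_complex_subspace[OF D] closed_closure] by metis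
    then have "x - m = 0"
      using closure_subset by (intro orth) blast
    then show ?thesis
      using m by simp
  qed
  then show ?thesis
    by blast
qed

text \<open>Linearity is automatic: the norm of \<open>V (x + y) - V x - V y\<close> is a combination of scalar
  products, hence equals its value for the identity.\<close>

lemma linear_if_cinner_preserving:
  fixes V :: "'a::complex_inner \<Rightarrow> 'b::complex_inner"
  assumes V: "\<And>x y. cinner (V x) (V y) = cinner x y"
  shows "Vector_Spaces.linear scaleC scaleC V"
proof -
  have "cinner (V (x + y) - V x - V y) (V (x + y) - V x - V y) = 0" for x y
    by (simp add: cinner_simps V)
  moreover have "cinner (V (c *\<^sub>C x) - c *\<^sub>C V x) (V (c *\<^sub>C x) - c *\<^sub>C V x) = 0" for c x
    by (simp add: cinner_simps V)
  ultimately show ?thesis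
    unfolding cinner_self_eq_0
    by (auto simp: Vector_Spaces.linear_iff vector_space_scaleC algebra_simps)
qed

lemma unitary_ontoI:
  "(\<And>x y. cinner (V x) (V y) = cinner x y) \<Longrightarrow> range V = N \<Longrightarrow> unitary_onto V N"
  by (simp add: unitary_onto_def linear_if_cinner_preserving)

lemma norm_if_cinner_preserving:
  assumes "\<And>x y. cinner (V x) (V y) = cinner x y"
  shows "norm (V x) = norm x"
proof -
  have "(norm (V x))\<^sup>2 = (norm x)\<^sup>2"
    by (simp add: norm_sq_cinner assms)
  then show ?thesis
    by simp
qed

lemma dist_if_cinner_preserving:
  assumes "\<And>x y. cinner (V x) (V y) = cinner x y"
  shows "dist (V x) (V y) = dist x y"
proof -
  have "(dist (V x) (V y))\<^sup>2 = (dist x y)\<^sup>2"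
    by (simp add: dist_norm norm_sq_cinner cinner_simps assms)
  then show ?thesis
    by simp
qed

section \<open>Exponentials of bounded skew-symmetric operators\<close>

definition exp_op :: "('a::banach \<Rightarrow> 'a) \<Rightarrow> real \<Rightarrow> 'a \<Rightarrow> 'a" where
  "exp_op S t x = (\<Sum>k. (t ^ k / fact k) *\<^sub>R (S ^^ k) x)"

lemma exp_op_0 [simp]: "exp_op S 0 x = x"
proof -
  \<comment> \<open>Since \<open>0 ^ 0 = 1\<close>, the term \<open>k = 0\<close> survives.\<close>
  have "(\<lambda>k. (0 ^ k / fact k) *\<^sub>R (S ^^ k) x) = (\<lambda>k. if k = 0 then x else 0)"
    by (auto simp: fun_eq_iff)
  then show ?thesis
    unfolding exp_op_def using sums_If_finite[of "\<lambda>k. k = 0" "\<lambda>_. x"] by (simp add: sums_iff)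
qed

text \<open>The series may be differentiated termwise on a bounded interval: the derivative of each
  term is \<open>S\<close> applied to the preceding one, so the derived series sums to
  \<open>S\<close> of the original and is dominated by a real exponential series.\<close>

lemma exp_op_has_vector_derivative:
  assumes S: "bounded_linear S"
  shows "((\<lambda>t. exp_op S t x) has_vector_derivative S (exp_op S t x)) (at t)"
proof -
  obtain K where K: "K > 0" "\<And>x. norm (S x) \<le> norm x * K"
    using bounded_linear.pos_bounded[OF S] by blast
  have pow: "norm ((S ^^ k) x) \<le> K ^ k * norm x" for k
    by (induction k) (auto intro!: order_trans[OF K(2)] mult_left_mono
        simp: K(1) less_imp_le mult.commute mult.left_commute)
  \<comment> \<open>The margin makes \<open>t\<close> an interior point of the interval on which
    convergence is uniform.\<close>
  define r where "r = \<bar>t\<bar> + 1"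
  define f where "f k s = (s ^ k / fact k) *\<^sub>R (S ^^ k) x" for k and s :: real
  define d where "d k s = (case k of 0 \<Rightarrow> 0 | Suc j \<Rightarrow> S (f j s))" for k and s :: real
  have nf: "norm (f k s) \<le> norm x * ((r * K) ^ k /\<^sub>R fact k)" if "s \<in> {-r<..<r}" for k s
  proof -
    have "\<bar>s\<bar> ^ k \<le> r ^ k"
      using that by (intro power_mono) auto
    then have "\<bar>s\<bar> ^ k / fact k * norm ((S ^^ k) x) \<le> r ^ k / fact k * (K ^ k * norm x)"
      using that by (intro mult_mono pow divide_right_mono) auto
    then show ?thesis
      by (simp add: f_def abs_mult power_abs power_mult_distrib field_simps)
  qed
  have sum_exp: "summable (\<lambda>k. norm x * ((r * K) ^ k /\<^sub>R fact k))"
    by (intro summable_mult summable_exp_generic)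
  have sf: "summable (\<lambda>k. f k s)" if "s \<in> {-r<..<r}" for s
    using nf[OF that] by (intro summable_comparison_test[OF _ sum_exp]) auto
  have der: "(f k has_vector_derivative d k s) (at s within T)" for k s T
  proof (cases k)
    case (Suc j)
    have "((\<lambda>s. s ^ Suc j / fact (Suc j)) has_vector_derivative s ^ j / fact j) (at s within T)"
      unfolding has_real_derivative_iff_has_vector_derivative[symmetric]
      using DERIV_cdivide[OF DERIV_pow[of "Suc j" s T], of "fact (Suc j)"]
      by (simp add: field_simps del: of_nat_Suc)
    then have "(f k has_vector_derivative (s ^ j / fact j) *\<^sub>R (S ^^ k) x) (at s within T)"
      unfolding f_def Suc using has_vector_derivative_scaleR[of "\<lambda>s. s ^ Suc j / fact (Suc j)"
          "s ^ j / fact j" s T "\<lambda>_. (S ^^ Suc j) x" 0]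
      by (simp add: has_real_derivative_iff_has_vector_derivative)
    then show ?thesis
      using bounded_linear.linear[OF S] by (simp add: Suc d_def f_def linear_scale)
  qed (simp add: f_def[abs_def] d_def)
  have "uniform_limit {-r<..<r} (\<lambda>n s. \<Sum>k<n. d k s) (\<lambda>s. \<Sum>k. d k s) sequentially"
  proof (rule Weierstrass_m_test)
    show "norm (d k s) \<le> (case k of 0 \<Rightarrow> 0 | Suc j \<Rightarrow> norm x * ((r * K) ^ j /\<^sub>R fact j) * K)"
      if "s \<in> {-r<..<r}" for k s
      using K(1) by (cases k) (auto simp only: d_def nat.case norm_zero
          intro!: order_trans[OF K(2)] mult_right_mono nf[OF that])
    show "summable (\<lambda>k. case k of 0 \<Rightarrow> 0 | Suc j \<Rightarrow> norm x * ((r * K) ^ j /\<^sub>R fact j) * K)"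
      by (subst summable_Suc_iff[symmetric]) (simp only: nat.case summable_mult2[OF sum_exp])
  qed
  moreover have "(\<Sum>k. d k s) = S (exp_op S s x)" if "s \<in> {-r<..<r}" for s
  proof -
    have "(\<lambda>j. d (Suc j) s) sums S (exp_op S s x)"
      using bounded_linear.sums[OF S summable_sums[OF sf[OF that]]]
      by (simp add: d_def exp_op_def f_def)
    \<comment> \<open>The index shift is free because \<open>d 0 s = 0\<close>, the constant term
      having derivative zero.\<close>
    then have "(\<lambda>j. d j s) sums S (exp_op S s x)"
      by (subst (asm) sums_Suc_iff) (simp add: d_def)
    then show ?thesis
      by (simp add: sums_iff)
  qed
  ultimately have lim: "uniform_limit {-r<..<r} (\<lambda>n s. \<Sum>k<n. d k s) (\<lambda>s. S (exp_op S s x)) sequentially"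
    by (rule uniform_limit_cong'[THEN iffD1, rotated 2, OF _ refl]) auto
  have "\<exists>g. \<forall>s\<in>{-r<..<r}. (\<lambda>k. f k s) sums g s \<and>
      (g has_derivative (\<lambda>h. h *\<^sub>R S (exp_op S s x))) (at s within {-r<..<r})"
  proof (rule has_derivative_series)
    show "(f k has_derivative (\<lambda>h. h *\<^sub>R d k s)) (at s within {-r<..<r})" for k s
      using der[of k s] by (simp add: has_vector_derivative_def)
    show "\<forall>\<^sub>F n in sequentially. \<forall>s\<in>{-r<..<r}. \<forall>h.
        norm ((\<Sum>k<n. h *\<^sub>R d k s) - h *\<^sub>R S (exp_op S s x)) \<le> \<epsilon> * norm h" if "\<epsilon> > 0" for \<epsilon>
      using uniform_limitD[OF lim that]
    proof eventually_elim
      case (elim n)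
      then have "norm ((\<Sum>k<n. d k s) - S (exp_op S s x)) \<le> \<epsilon>" if "s \<in> {-r<..<r}" for s
        using that by (simp add: dist_norm less_imp_le)
      then show ?case
        by (auto simp: mult.commute[of \<epsilon>] simp flip: scaleR_sum_right scaleR_diff_right
            intro!: mult_left_mono)
    qed
    show "0 \<in> {-r<..<r}"
      by (auto simp: r_def)
    then show "(\<lambda>k. f k 0) sums (\<Sum>k. f k 0)"
      by (intro summable_sums sf)
  qed (rule convex_real_interval)
  then obtain g where g: "\<And>s. s \<in> {-r<..<r} \<Longrightarrow> (\<lambda>k. f k s) sums g s"
    "\<And>s. s \<in> {-r<..<r} \<Longrightarrow> (g has_derivative (\<lambda>h. h *\<^sub>R S (exp_op S s x))) (at s within {-r<..<r})"
    by blast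
  have t: "t \<in> {-r<..<r}"
    by (auto simp: r_def)
  have "((\<lambda>s. exp_op S s x) has_derivative (\<lambda>h. h *\<^sub>R S (exp_op S t x))) (at t within {-r<..<r})"
    by (rule has_derivative_transform[OF t _ g(2)[OF t]])
      (use g(1) in \<open>simp add: exp_op_def f_def sums_iff\<close>)
  then show ?thesis
    unfolding has_vector_derivative_def at_within_open[OF t open_greaterThanLessThan] .
qed

text \<open>Mean value inequality. With \<open>C = 0\<close> it gives conservation laws; with
  positive \<open>C\<close> it compares two exponentials.\<close>

lemma vector_derivative_bound:
  fixes u :: "real \<Rightarrow> 'a::real_normed_vector"
  assumes "\<And>s. (u has_vector_derivative u' s) (at s)" and "\<And>s. norm (u' s) \<le> C"
  shows "norm (u t - u 0) \<le> C * \<bar>t\<bar>"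
proof -
  have "norm (u t - u 0) \<le> C * norm (t - 0)"
    by (rule differentiable_bound[of UNIV u "\<lambda>s h. h *\<^sub>R u' s"])
      (use assms in \<open>auto simp: has_vector_derivative_def mult.commute[of C]
        intro!: onorm_le mult_left_mono\<close>)
  then show ?thesis
    by simp
qed

lemma cinner_has_vector_derivative:
  assumes "(u has_vector_derivative u') (at t)" and "(v has_vector_derivative v') (at t)"
  shows "((\<lambda>t. cinner (u t) (v t)) has_vector_derivative cinner (u t) v' + cinner u' (v t)) (at t)"
  by (rule cinner.has_vector_derivative[OF assms])

lemma cinner_constant:
  assumes "\<And>t. (u has_vector_derivative u' t) (at t)" and "\<And>t. (v has_vector_derivative v' t) (at t)"
    and "\<And>t. cinner (u' t) (v t) = - cinner (u t) (v' t)"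
  shows "cinner (u t) (v t) = cinner (u 0) (v 0)"
  using vector_derivative_bound[OF cinner_has_vector_derivative[OF assms(1,2)], of 0 t]
  by (simp add: assms(3))

section \<open>The unitary group of a bounded skew-symmetric operator\<close>

locale bounded_skew =
  fixes S :: "'a::chilbert_space \<Rightarrow> 'a"
  assumes bounded_linear: "bounded_linear S"
    and skew: "cinner (S x) y = - cinner x (S y)"
begin

lemmas derivative = exp_op_has_vector_derivative[OF bounded_linear]

lemma isometry: "cinner (exp_op S t x) (exp_op S t y) = cinner x y"
  using cinner_constant[OF derivative derivative, of x y t] by (simp add: skew)

text \<open>The difference of two solutions is again a solution; skewness conserves its norm, which
  is zero at time 0.\<close>

lemma solution_unique:
  assumes u: "\<And>t. (u has_vector_derivative S (u t)) (at t)"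
  shows "u t = exp_op S t (u 0)"
proof -
  define z where "z t = u t - exp_op S t (u 0)" for t
  have "(z has_vector_derivative S (z t)) (at t)" for t
    unfolding z_def
    by (rule derivative_eq_intros u derivative refl)+
      (simp add: linear_diff bounded_linear.linear[OF bounded_linear])
  from cinner_constant[OF this this, of t] have "cinner (z t) (z t) = 0"
    by (simp add: skew z_def)
  then show ?thesis
    by (simp add: cinner_self_eq_0 z_def)
qed

text \<open>As functions of \<open>s\<close>, both sides solve the same equation with value
  \<open>exp_op S t x\<close> at \<open>s = 0\<close>.\<close>

lemma exp_op_add: "exp_op S (s + t) x = exp_op S s (exp_op S t x)"
proof -
  have "((\<lambda>s. exp_op S (s + t) x) has_vector_derivative S (exp_op S (s + t) x)) (at s)" for s
    using vector_diff_chain_at[OF _ derivative, of "\<lambda>s. s + t" 1 s x]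
    by (simp add: o_def has_vector_derivative_add_const has_vector_derivative_id)
  from solution_unique[OF this] show ?thesis
    by simp
qed

lemma exp_op_diff: "exp_op S t (x - y) = exp_op S t x - exp_op S t y"
  using linear_if_cinner_preserving[of "exp_op S t"] isometry
  unfolding Vector_Spaces.linear_def by (auto intro: module_hom.diff)

lemma norm_exp_op: "norm (exp_op S t x) = norm x"
  by (rule norm_if_cinner_preserving) (rule isometry)

text \<open>Applying \<open>T\<close> to a solution gives the solution that starts at
  \<open>T x\<close>.\<close>

lemma exp_op_commute:
  assumes "bounded_linear T" and "\<And>x. T (S x) = S (T x)"
  shows "T (exp_op S t x) = exp_op S t (T x)"
proof -
  have "((\<lambda>t. T (exp_op S t x)) has_vector_derivative S (T (exp_op S t x))) (at t)" for t
    using bounded_linear.has_vector_derivative[OF assms(1) derivative] by (simp add: assms(2))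
  from solution_unique[OF this] show ?thesis
    by simp
qed

end

text \<open>A Duhamel argument in weak form: the two exponentials are compared along one scalar
  function of \<open>s\<close> whose derivative contains only the difference of the operators. The
  bound involves \<open>S x - T x\<close> alone, not the operator norms, so it survives an unbounded
  limit.\<close>

lemma norm_exp_op_diff:
  assumes S: "bounded_skew S" and T: "bounded_skew T" and comm: "\<And>x. S (T x) = T (S x)"
  shows "norm (exp_op S t x - exp_op T t x) \<le> \<bar>t\<bar> * norm (S x - T x)"
proof -
  interpret S: bounded_skew S by fact
  interpret T: bounded_skew T by fact
  define w where "w = exp_op S t x - exp_op T t x"
  \<comment> \<open>Pulling \<open>w\<close> back to time 0 makes the scalar product with
    \<open>exp_op S s y\<close> pair \<open>w\<close> with \<open>exp_op T t x\<close> at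
    \<open>s = t\<close>, and with \<open>exp_op S t x\<close> at \<open>s = 0\<close> by
    isometry.\<close>
  define y where "y = exp_op S (- t) w"
  have y: "exp_op S t y = w"
    unfolding y_def by (simp flip: S.exp_op_add)
  define \<phi> where "\<phi> s = cinner (exp_op S s y) (exp_op T s x)" for s
  have "(\<phi> has_vector_derivative cinner (exp_op S s y) (T (exp_op T s x) - S (exp_op T s x))) (at s)"
    for s
    using cinner_has_vector_derivative[OF S.derivative[of y s] T.derivative[of x s]]
    by (simp add: \<phi>_def[abs_def] S.skew cinner_diff_right)
  moreover have "cmod (cinner (exp_op S s y) (T (exp_op T s x) - S (exp_op T s x)))
      \<le> norm w * norm (S x - T x)" for s
  proof -
    \<comment> \<open>By commutation the defect is an isometric image of \<open>T x - S x\<close>,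
      so its norm does not depend on \<open>s\<close>.\<close>
    have "T (exp_op T s x) - S (exp_op T s x) = exp_op T s (T x - S x)"
      by (simp add: T.exp_op_diff T.exp_op_commute S.bounded_linear T.bounded_linear comm)
    then show ?thesis
      using Cauchy_Schwarz[of "exp_op S s y" "exp_op T s (T x - S x)"]
      by (simp add: S.norm_exp_op T.norm_exp_op y_def norm_minus_commute)
  qed
  ultimately have "cmod (\<phi> t - \<phi> 0) \<le> norm w * norm (S x - T x) * \<bar>t\<bar>"
    by (rule vector_derivative_bound)
  moreover have "\<phi> t - \<phi> 0 = - cinner w w"
    using S.isometry[of t y x] by (simp add: \<phi>_def y w_def cinner_diff_right)
  ultimately have "norm w * norm w \<le> norm w * (\<bar>t\<bar> * norm (S x - T x))"
    by (simp add: cinner_self norm_mult power2_eq_square mult.assoc mult.commute mult.left_commute)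
  then show ?thesis
    unfolding w_def[symmetric] by (cases "w = 0") auto
qed

section \<open>Stone's theorem\<close>

text \<open>The usual three-epsilon argument, with nonexpansiveness supplying the uniform bound in
  \<open>n\<close>.\<close>

lemma tendsto_if_tendsto_on_dense:
  fixes T :: "nat \<Rightarrow> 'a::real_normed_vector \<Rightarrow> 'a"
  assumes diff: "\<And>n x y. norm (T n x - T n y) \<le> norm (x - y)"
    and dense: "closure D = UNIV" and lim: "\<And>x. x \<in> D \<Longrightarrow> (\<lambda>n. T n x) \<longlonglongrightarrow> x"
  shows "(\<lambda>n. T n x) \<longlonglongrightarrow> x"
proof (rule metric_LIMSEQ_I)
  fix \<epsilon> :: real assume \<epsilon>: "\<epsilon> > 0"
  obtain y where y: "y \<in> D" "dist y x < \<epsilon> / 3"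
    using dense \<epsilon> by (metis UNIV_I closure_approachable divide_pos_pos zero_less_numeral)
  obtain N where N: "\<And>n. n \<ge> N \<Longrightarrow> dist (T n y) y < \<epsilon> / 3"
    using metric_LIMSEQ_D[OF lim[OF y(1)], of "\<epsilon> / 3"] \<epsilon> by auto
  have "dist (T n x) x < \<epsilon>" if "n \<ge> N" for n
    using N[OF that] y(2) diff[of n x y]
      dist_triangle[of "T n x" x "T n y"] dist_triangle[of "T n y" x y]
    by (simp add: dist_norm norm_minus_commute)
  then show "\<exists>N. \<forall>n\<ge>N. dist (T n x) x < \<epsilon>"
    by blast
qed

text \<open>\<open>mem_iff\<close> says on graphs that the adjoint of \<open>B\<close> is
  \<open>- B\<close>: its right side states that \<open>(x', - y')\<close> lies in the adjoint.
  Density of the domain is a consequence, proved in \<open>dense\<close>.\<close>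

locale skew_adjoint =
  fixes B :: "('a::chilbert_space, 'a) operator"
  assumes linear: "linear_operator B"
    and mem_iff: "(x', y') \<in> B \<longleftrightarrow> (\<forall>(x, y)\<in>B. cinner y x' = - cinner x y')"
begin

lemma subspace: "complex_vector.subspace B"
  using linear by (simp add: linear_operator_def)

lemma memI: "(\<And>x y. (x, y) \<in> B \<Longrightarrow> cinner y x' = - cinner x y') \<Longrightarrow> (x', y') \<in> B"
  using mem_iff[of x' y'] by blast

lemma unique: "(x, y) \<in> B \<Longrightarrow> (x, y') \<in> B \<Longrightarrow> y = y'"
  using linear by (auto simp: linear_operator_def single_valued_def)

lemma skew: "(x, y) \<in> B \<Longrightarrow> (x', y') \<in> B \<Longrightarrow> cinner y x' = - cinner x y'"
  using mem_iff by blast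

lemma zero: "(0, 0) \<in> B"
  using complex_vector.subspace_0[OF subspace] by (simp add: zero_prod_def)

lemma add: "(x, y) \<in> B \<Longrightarrow> (x', y') \<in> B \<Longrightarrow> (x + x', y + y') \<in> B"
  using complex_vector.subspace_add[OF subspace] by fastforce

lemma diff: "(x, y) \<in> B \<Longrightarrow> (x', y') \<in> B \<Longrightarrow> (x - x', y - y') \<in> B"
  using complex_vector.subspace_diff[OF subspace] by fastforce

lemma scaleC: "(x, y) \<in> B \<Longrightarrow> (c *\<^sub>C x, c *\<^sub>C y) \<in> B"
  using complex_vector.subspace_scale[OF subspace, of "(x, y)" c] by (simp add: scaleC_prod_def)

lemma scaleR: "(x, y) \<in> B \<Longrightarrow> (r *\<^sub>R x, r *\<^sub>R y) \<in> B"
  by (simp add: scaleR_scaleC scaleC)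

text \<open>\<open>mem_iff\<close> presents the graph as an intersection of sets cut out by
  equations between continuous functions.\<close>

lemma closed: "closed B"
proof -
  have "p \<in> B \<longleftrightarrow> (\<forall>q\<in>B. cinner (snd q) (fst p) = - cinner (fst q) (snd p))" for p
    using mem_iff[of "fst p" "snd p"] by (simp add: case_prod_unfold)
  then have "B = (\<Inter>q\<in>B. {p. cinner (snd q) (fst p) = - cinner (fst q) (snd p)})"
    by blast
  also have "closed \<dots>"
    by (intro closed_INT ballI closed_Collect_eq continuous_intros cinner.continuous_on)
  finally show ?thesis .
qed

text \<open>The set is the graph of \<open>B\<close> divided by \<open>r\<close>; this reduces the
  solvability of \<open>r - B\<close> to that of \<open>1 - B\<close>.\<close>

lemma scaled:
  assumes "r \<noteq> 0"
  shows "skew_adjoint {(x, y). (x, r *\<^sub>R y) \<in> B}" (is "skew_adjoint ?B")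
proof
  show "linear_operator ?B"
    unfolding linear_operator_def single_valued_def
  proof (intro conjI allI impI complex_vector.subspaceI)
    show "c *\<^sub>C p \<in> ?B" if "p \<in> ?B" for c p
      using that scaleC[of "fst p" "r *\<^sub>R snd p" c]
      by (auto simp: scaleC_prod_def scaleR_scaleC scaleC_scaleC mult.commute)
    show "y = y'" if "(x, y) \<in> ?B" "(x, y') \<in> ?B" for x y y'
      using that unique[of x "r *\<^sub>R y" "r *\<^sub>R y'"] assms by simp
  qed (auto simp: zero add scaleR_add_right zero_prod_def)
  fix x' y'
  show "(x', y') \<in> ?B \<longleftrightarrow> (\<forall>(x, y)\<in>?B. cinner y x' = - cinner x y')"
  proof
    assume mem: "(x', y') \<in> ?B"
    show "\<forall>(x, y)\<in>?B. cinner y x' = - cinner x y'"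
    proof safe
      fix x y assume "(x, r *\<^sub>R y) \<in> B"
      from skew[OF this, of x' "r *\<^sub>R y'"] mem show "cinner y x' = - cinner x y'"
        using assms by (simp add: cinner_scaleR_left cinner_scaleR_right flip: scaleR_minus_right)
    qed
  next
    assume adj: "\<forall>(x, y)\<in>?B. cinner y x' = - cinner x y'"
    have "(x', r *\<^sub>R y') \<in> B"
    proof (rule memI)
      fix x y assume "(x, y) \<in> B"
      then have "(x, inverse r *\<^sub>R y) \<in> ?B"
        using assms by simp
      then have "cinner (inverse r *\<^sub>R y) x' = - cinner x y'"
        using adj by blast
      then have "r *\<^sub>R cinner (inverse r *\<^sub>R y) x' = - (r *\<^sub>R cinner x y')"
        by simp
      then show "cinner y x' = - cinner x (r *\<^sub>R y')"
        using assms by (simp add: cinner_scaleR_left cinner_scaleR_right)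
    qed
    then show "(x', y') \<in> ?B"
      by simp
  qed
qed

text \<open>The orthogonal complement of the graph of a skew-adjoint operator is the graph with its
  coordinates exchanged, so \<open>(z, 0) = (x, y) + (p, q)\<close> with \<open>(x, y), (q, p) \<in> B\<close>, and \<open>x - q\<close> is
  the solution.\<close>

lemma range_one: "\<exists>w. (w, w - z) \<in> B"
proof -
  obtain m where m: "m \<in> B" "\<And>p. p \<in> B \<Longrightarrow> cinner p ((z, 0) - m) = 0"
    using orthogonal_decomposition[OF subspace closed] by metis
  obtain x y where xy: "m = (x, y)"
    by fastforce
  have "(- y, z - x) \<in> B"
  proof (rule memI)
    fix u v assume "(u, v) \<in> B"
    from m(2)[OF this] show "cinner v (- y) = - cinner u (z - x)"
      by (simp add: xy cinner_prod_def add_eq_0_iff)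
  qed
  then have "(x + y, y - (z - x)) \<in> B"
    using diff[of x y "- y" "z - x"] m(1) by (simp add: xy)
  then show ?thesis
    by (intro exI[of _ "x + y"]) (simp add: algebra_simps)
qed

section \<open>Resolvents at nonzero real points\<close>

lemma range_all:
  assumes "r \<noteq> 0"
  shows "\<exists>w. (w, r *\<^sub>R w - z) \<in> B"
proof -
  interpret s: skew_adjoint "{(x, y). (x, r *\<^sub>R y) \<in> B}"
    by (rule scaled) fact
  show ?thesis
    using s.range_one[of "inverse r *\<^sub>R z"] assms by (simp add: scaleR_diff_right)
qed

text \<open>Here \<open>z\<close> is \<open>(r - B) w\<close>. Skewness makes
  \<open>cinner w b\<close> purely imaginary, so \<open>r w\<close> and \<open>b\<close> are
  orthogonal for the real part and Pythagoras applies.\<close>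

lemma norm_le:
  assumes "(w, r *\<^sub>R w - z) \<in> B"
  shows "\<bar>r\<bar> * norm w \<le> norm z"
proof -
  define b where "b = r *\<^sub>R w - z"
  have "cinner b w = - cinner w b"
    using assms skew by (simp add: b_def)
  then have "Re (cinner w b) = 0"
    using arg_cong[OF cinner_commute[of b w], of Re] by simp
  then have "(norm (r *\<^sub>R w - b))\<^sup>2 = (\<bar>r\<bar> * norm w)\<^sup>2 + (norm b)\<^sup>2"
    by (simp add: norm_diff_sq cinner_scaleR_left power_mult_distrib)
  then have "(\<bar>r\<bar> * norm w)\<^sup>2 \<le> (norm z)\<^sup>2"
    by (simp add: b_def)
  then show ?thesis
    by (rule power2_le_imp_le) simp
qed

text \<open>This is the inverse of \<open>r - B\<close>. For \<open>r\<close> nonzero the choice is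
  possible by \<open>range_all\<close> and unambiguous by \<open>norm_le\<close>, as
  \<open>resolvent_eq\<close> records.\<close>

definition resolvent :: "real \<Rightarrow> 'a \<Rightarrow> 'a" where
  "resolvent r z = (SOME w. (w, r *\<^sub>R w - z) \<in> B)"

lemma resolvent_mem: "r \<noteq> 0 \<Longrightarrow> (resolvent r z, r *\<^sub>R resolvent r z - z) \<in> B"
  unfolding resolvent_def by (rule someI_ex) (rule range_all)

lemma resolvent_eq:
  assumes "r \<noteq> 0" and "(w, r *\<^sub>R w - z) \<in> B"
  shows "resolvent r z = w"
proof -
  have "(w - resolvent r z, r *\<^sub>R (w - resolvent r z) - 0) \<in> B"
    using diff[OF assms(2) resolvent_mem[OF assms(1), of z]] by (simp add: algebra_simps)
  from norm_le[OF this] show ?thesis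
    using assms(1) by (simp add: mult_le_0_iff)
qed

lemma norm_resolvent: "r \<noteq> 0 \<Longrightarrow> \<bar>r\<bar> * norm (resolvent r z) \<le> norm z"
  by (rule norm_le[OF resolvent_mem])

lemma bounded_linear_resolvent:
  assumes r: "r \<noteq> 0"
  shows "bounded_linear (resolvent r)"
proof (rule bounded_linear_intro[of _ "1 / \<bar>r\<bar>"])
  show "resolvent r (x + y) = resolvent r x + resolvent r y" for x y
    using add[OF resolvent_mem[OF r, of x] resolvent_mem[OF r, of y]]
    by (intro resolvent_eq[OF r]) (simp add: algebra_simps)
  show "resolvent r (s *\<^sub>R x) = s *\<^sub>R resolvent r x" for s x
    using scaleR[OF resolvent_mem[OF r, of x], of s]
    by (intro resolvent_eq[OF r]) (simp add: algebra_simps)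
  show "norm (resolvent r x) \<le> norm x * (1 / \<bar>r\<bar>)" for x
    using norm_resolvent[OF r, of x] r by (simp add: field_simps)
qed

text \<open>The adjoint of the inverse of \<open>r - B\<close> is the inverse of
  \<open>r + B\<close>, that is, minus the resolvent at \<open>- r\<close>. A skew-symmetric
  combination therefore has to pair the points \<open>r\<close> and \<open>- r\<close>.\<close>

lemma resolvent_skew:
  assumes "r \<noteq> 0"
  shows "cinner (resolvent r x) y = - cinner x (resolvent (- r) y)"
  using skew[OF resolvent_mem[of r x] resolvent_mem[of "- r" y]] assms
  by (simp add: cinner_simps)

lemma resolvent_commute_operator:
  assumes r: "r \<noteq> 0" and xy: "(x, y) \<in> B"
  shows "(resolvent r x, resolvent r y) \<in> B"
proof -
  \<comment> \<open>This is the value of \<open>B\<close> at \<open>resolvent r x\<close>; it is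
    shown to solve the equation that characterizes \<open>resolvent r y\<close>.\<close>
  define w where "w = r *\<^sub>R resolvent r x - x"
  have "(r *\<^sub>R resolvent r x - x, r *\<^sub>R w - y) \<in> B"
    using diff[OF scaleR[OF resolvent_mem[OF r, of x], of r] xy] by (simp add: w_def)
  then have "resolvent r y = w"
    by (intro resolvent_eq[OF r]) (simp add: w_def)
  then show ?thesis
    using resolvent_mem[OF r, of x] by (simp add: w_def)
qed

text \<open>Since \<open>resolvent s\<close> commutes with \<open>B\<close>, it carries the equation
  for \<open>resolvent r z\<close> into the one with right side
  \<open>resolvent s z\<close>.\<close>

lemma resolvent_commute:
  assumes "r \<noteq> 0" and "s \<noteq> 0"
  shows "resolvent r (resolvent s z) = resolvent s (resolvent r z)"
proof (rule resolvent_eq[OF assms(1)])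
  interpret bounded_linear "resolvent s"
    by (rule bounded_linear_resolvent) fact
  show "(resolvent s (resolvent r z), r *\<^sub>R resolvent s (resolvent r z) - resolvent s z) \<in> B"
    using resolvent_commute_operator[OF assms(2) resolvent_mem[OF assms(1)], of z]
    by (simp add: diff scaleR)
qed

text \<open>Obtained by applying the resolvent to \<open>(r - B) x = r x - y\<close>. It exhibits
  the error of \<open>r\<close> times the resolvent as \<open>resolvent r y\<close>, which is of
  order \<open>1 / r\<close>.\<close>

lemma resolvent_on_domain:
  assumes r: "r \<noteq> 0" and xy: "(x, y) \<in> B"
  shows "r *\<^sub>R resolvent r x = x + resolvent r y"
proof -
  interpret bounded_linear "resolvent r"
    by (rule bounded_linear_resolvent) fact
  have "resolvent r (r *\<^sub>R x - y) = x"
    using xy by (intro resolvent_eq[OF r]) simp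
  then show ?thesis
    by (simp add: diff scaleR algebra_simps)
qed

text \<open>A vector \<open>z\<close> orthogonal to the domain satisfies the membership test for
  \<open>(0, z)\<close>, and single-valuedness gives \<open>z = 0\<close>.\<close>

lemma dense: "closure (Domain B) = UNIV"
proof (rule dense_subspace_if_orth_0)
  show "complex_vector.subspace (Domain B)"
    by (rule complex_vector.subspaceI) (use zero add scaleC in blast)+
  fix z assume "\<And>x. x \<in> Domain B \<Longrightarrow> cinner x z = 0"
  then have "(0, z) \<in> B"
    by (intro memI) (auto simp: Domain_iff)
  then show "z = 0"
    using unique zero by blast
qed

text \<open>On the domain the error has norm at most \<open>norm y\<close> divided by the modulus of
  \<open>r n\<close>; nonexpansiveness extends the limit to all vectors. Signs are left free so that
  both halves of \<open>approx\<close> are covered.\<close>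

lemma resolvent_tendsto:
  assumes r: "\<And>n. r n \<noteq> 0" and lim: "(\<lambda>n. 1 / \<bar>r n\<bar>) \<longlonglongrightarrow> 0"
  shows "(\<lambda>n. r n *\<^sub>R resolvent (r n) z) \<longlonglongrightarrow> z"
proof (rule tendsto_if_tendsto_on_dense[OF _ dense])
  fix n x y
  interpret bounded_linear "resolvent (r n)"
    by (rule bounded_linear_resolvent) fact
  show "norm (r n *\<^sub>R resolvent (r n) x - r n *\<^sub>R resolvent (r n) y) \<le> norm (x - y)"
    using norm_resolvent[OF r[of n], of "x - y"] by (simp flip: scaleR_diff_right diff)
next
  fix x assume "x \<in> Domain B"
  then obtain y where xy: "(x, y) \<in> B"
    by blast
  have "(\<lambda>n. resolvent (r n) y) \<longlonglongrightarrow> 0"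
  proof (rule Lim_null_comparison)
    show "\<forall>\<^sub>F n in sequentially. norm (resolvent (r n) y) \<le> 1 / \<bar>r n\<bar> * norm y"
      using norm_resolvent[OF r, of _ y] r by (auto intro!: always_eventually simp: field_simps)
    show "(\<lambda>n. 1 / \<bar>r n\<bar> * norm y) \<longlonglongrightarrow> 0"
      using tendsto_mult_left_zero[OF lim] .
  qed
  then show "(\<lambda>n. r n *\<^sub>R resolvent (r n) x) \<longlonglongrightarrow> x"
    using tendsto_add[OF tendsto_const[of x]] by (fastforce simp: resolvent_on_domain[OF r xy])
qed

text \<open>With \<open>r = n + 1\<close> this is \<open>B (1 - B\<^sup>2 / r\<^sup>2)\<^sup>-\<^sup>1\<close>, the mean of the Yosida
  approximations \<open>B (1 - B / r)\<^sup>-\<^sup>1\<close> and \<open>B (1 + B / r)\<^sup>-\<^sup>1\<close>. Unlike either of them it is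
  skew-symmetric, so its exponentials are unitary.\<close>

definition approx :: "nat \<Rightarrow> 'a \<Rightarrow> 'a" where
  "approx n z = ((real (Suc n))\<^sup>2 / 2) *\<^sub>R (resolvent (real (Suc n)) z + resolvent (- real (Suc n)) z)"

lemma bounded_linear_approx: "bounded_linear (approx n)"
  unfolding approx_def
  by (intro bounded_linear_add bounded_linear_compose[OF bounded_linear_scaleR_right]
      bounded_linear_resolvent) auto

lemma approx_skew: "bounded_skew (approx n)"
proof (rule bounded_skew.intro)
  fix x y
  show "cinner (approx n x) y = - cinner x (approx n y)"
    using resolvent_skew[of "real (Suc n)" x y] resolvent_skew[of "- real (Suc n)" x y]
    by (simp add: approx_def cinner_simps algebra_simps del: of_nat_Suc)
qed (rule bounded_linear_approx)

lemma approx_commute: "approx m (approx n z) = approx n (approx m z)"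
proof -
  have lin: "linear (resolvent (real (Suc k)))" "linear (resolvent (- real (Suc k)))" for k
    using bounded_linear_resolvent[of "real (Suc k)"] bounded_linear_resolvent[of "- real (Suc k)"]
    by (auto intro: bounded_linear.linear)
  show ?thesis
    unfolding approx_def
    by (simp add: linear_add[OF lin(1)] linear_add[OF lin(2)] linear_scale[OF lin(1)]
        linear_scale[OF lin(2)] scaleR_add_right resolvent_commute[of "real (Suc m)" "real (Suc n)"]
        resolvent_commute[of "real (Suc m)" "- real (Suc n)"]
        resolvent_commute[of "- real (Suc m)" "real (Suc n)"]
        resolvent_commute[of "- real (Suc m)" "- real (Suc n)"] ac_simps del: of_nat_Suc)
qed

lemma approx_tendsto:
  assumes xy: "(x, y) \<in> B"
  shows "(\<lambda>n. approx n x) \<longlonglongrightarrow> y"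
proof -
  have "approx n x = (1/2) *\<^sub>R (real (Suc n) *\<^sub>R resolvent (real (Suc n)) y
      + (- real (Suc n)) *\<^sub>R resolvent (- real (Suc n)) y)" for n
  proof -
    define r where "r = real (Suc n)"
    have r: "r \<noteq> 0"
      by (simp add: r_def)
    \<comment> \<open>The two copies of \<open>x\<close> from \<open>resolvent_on_domain\<close> at
      \<open>r\<close> and \<open>- r\<close> cancel, leaving resolvents of \<open>y\<close>, which
      the remaining factor \<open>r / 2\<close> turns into a mean of two sequences tending to
      \<open>y\<close>.\<close>
    have "r *\<^sub>R resolvent r x + r *\<^sub>R resolvent (- r) x = resolvent r y - resolvent (- r) y"
    proof -
      have "r *\<^sub>R resolvent (- r) x = - (x + resolvent (- r) y)"
        using resolvent_on_domain[OF _ xy, of "- r"] r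
        by (metis minus_minus neg_equal_0_iff_equal scaleR_minus_left)
      then show ?thesis
        by (simp add: resolvent_on_domain[OF r xy])
    qed
    then have "(r / 2) *\<^sub>R (r *\<^sub>R resolvent r x + r *\<^sub>R resolvent (- r) x)
        = (r / 2) *\<^sub>R (resolvent r y - resolvent (- r) y)"
      by simp
    then show ?thesis
      unfolding approx_def r_def[symmetric] by (simp add: power2_eq_square algebra_simps)
  qed
  moreover have "(\<lambda>n. 1 / \<bar>real (Suc n)\<bar>) \<longlonglongrightarrow> 0"
    using LIMSEQ_inverse_real_of_nat by (simp add: inverse_eq_divide)
  then have "(\<lambda>n. (1/2) *\<^sub>R (real (Suc n) *\<^sub>R resolvent (real (Suc n)) y
      + (- real (Suc n)) *\<^sub>R resolvent (- real (Suc n)) y)) \<longlonglongrightarrow> (1/2) *\<^sub>R (y + y)"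
    by (intro tendsto_intros resolvent_tendsto) (auto simp del: of_nat_Suc)
  ultimately show ?thesis
    by (simp flip: scaleR_2)
qed

section \<open>The limit group\<close>

definition group :: "real \<Rightarrow> 'a \<Rightarrow> 'a" where
  "group t x = lim (\<lambda>n. exp_op (approx n) t x)"

lemma norm_exp_approx_diff: "norm (exp_op (approx n) t x - exp_op (approx n) t y) = norm (x - y)"
  by (simp add: bounded_skew.norm_exp_op[OF approx_skew]
      flip: bounded_skew.exp_op_diff[OF approx_skew])

text \<open>Replacing \<open>x\<close> by a nearby \<open>y\<close> of the domain costs the same for
  all \<open>n\<close> and \<open>t\<close>, the exponentials being isometric. On the domain
  \<open>norm_exp_op_diff\<close> bounds the difference by the time times the distance of the
  convergent vectors \<open>approx m y\<close> and \<open>approx n y\<close>.\<close>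

lemma group_uniform_limit:
  "uniform_limit {-r..r} (\<lambda>n t. exp_op (approx n) t x) (\<lambda>t. group t x) sequentially"
proof -
  have "uniformly_Cauchy_on {-r..r} (\<lambda>n t. exp_op (approx n) t x)"
  proof (rule uniformly_Cauchy_onI)
    fix \<epsilon> :: real assume \<epsilon>: "\<epsilon> > 0"
    have "x \<in> closure (Domain B)"
      by (simp add: dense)
    then have "\<epsilon> / 4 > 0 \<Longrightarrow> \<exists>y\<in>Domain B. dist y x < \<epsilon> / 4"
      unfolding closure_approachable by (rule allE[of _ "\<epsilon> / 4"]) (rule mp)
    with \<epsilon> have "\<exists>y\<in>Domain B. dist y x < \<epsilon> / 4"
      by simp
    then obtain y z where yz: "(y, z) \<in> B" and "dist y x < \<epsilon> / 4"
      by blast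
    then have y: "norm (y - x) < \<epsilon> / 4"
      by (simp only: dist_norm)
    \<comment> \<open>A strictly positive bound for the times considered, so that division by it is
      safe even if \<open>r = 0\<close>.\<close>
    define C where "C = \<bar>r\<bar> + 1"
    have C: "C > 0"
      unfolding C_def by arith
    define \<delta> where "\<delta> = \<epsilon> / (2 * C)"
    have \<delta>: "\<delta> > 0" "C * \<delta> = \<epsilon> / 2"
      using \<epsilon> C by (simp_all add: \<delta>_def)
    obtain N where N: "\<And>m n. m \<ge> N \<Longrightarrow> n \<ge> N \<Longrightarrow> dist (approx m y) (approx n y) < \<delta>"
      using metric_CauchyD[OF LIMSEQ_imp_Cauchy[OF approx_tendsto[OF yz]] \<delta>(1)] by blast
    have "dist (exp_op (approx m) t x) (exp_op (approx n) t x) < \<epsilon>"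
      if t: "t \<in> {-r..r}" and mn: "m \<ge> N" "n \<ge> N" for t m n
    proof -
      have "dist (exp_op (approx m) t y) (exp_op (approx n) t y) \<le> \<bar>t\<bar> * dist (approx m y) (approx n y)"
        unfolding dist_norm by (intro norm_exp_op_diff approx_skew approx_commute)
      also have "\<dots> \<le> C * \<delta>"
        using t C by (intro mult_mono less_imp_le[OF N[OF mn]]) (auto simp: C_def)
      also have "\<dots> = \<epsilon> / 2"
        by (rule \<delta>)
      finally show ?thesis
        using y norm_exp_approx_diff[of m t x y] norm_exp_approx_diff[of n t y x]
          norm_minus_commute[of x y]
          dist_triangle[of "exp_op (approx m) t x" "exp_op (approx n) t x" "exp_op (approx m) t y"]
          dist_triangle[of "exp_op (approx m) t y" "exp_op (approx n) t x" "exp_op (approx n) t y"]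
        unfolding dist_norm by linarith
    qed
    then show "\<exists>M. \<forall>t\<in>{-r..r}. \<forall>m\<ge>M. \<forall>n\<ge>M.
        dist (exp_op (approx m) t x) (exp_op (approx n) t x) < \<epsilon>"
      by (intro exI[of _ N] ballI allI impI)
  qed
  then have "uniformly_convergent_on {-r..r} (\<lambda>n t. exp_op (approx n) t x)"
    by (rule Cauchy_uniformly_convergent)
  then show ?thesis
    by (simp add: uniformly_convergent_uniform_limit_iff group_def)
qed

lemma group_tendsto: "(\<lambda>n. exp_op (approx n) t x) \<longlonglongrightarrow> group t x"
  by (rule tendsto_uniform_limitI[OF group_uniform_limit[where r = "\<bar>t\<bar>"]]) auto

lemma group_isometry: "cinner (group t x) (group t y) = cinner x y"
  by (rule LIMSEQ_unique[OF cinner.tendsto[OF group_tendsto group_tendsto]])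
    (simp add: bounded_skew.isometry[OF approx_skew])

lemma group_0: "group 0 = id"
  by (simp add: group_def fun_eq_iff)

lemma group_add: "group (s + t) x = group s (group t x)"
proof (rule LIMSEQ_unique[OF group_tendsto])
  have "(\<lambda>n. norm (exp_op (approx n) t x - group t x)) \<longlonglongrightarrow> 0"
    by (rule tendsto_norm_zero) (rule LIM_zero[OF group_tendsto])
  \<comment> \<open>The inner exponential may be replaced by its limit, since the outer ones
    preserve distances for every \<open>n\<close>.\<close>
  then have "(\<lambda>n. norm (exp_op (approx n) s (exp_op (approx n) t x) - exp_op (approx n) s (group t x))) \<longlonglongrightarrow> 0"
    by (simp only: norm_exp_approx_diff)
  from tendsto_add[OF tendsto_norm_zero_cancel[OF this] group_tendsto[of s "group t x"]]
  show "(\<lambda>n. exp_op (approx n) (s + t) x) \<longlonglongrightarrow> group s (group t x)"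
    by (simp add: bounded_skew.exp_op_add[OF approx_skew])
qed

lemma continuous_group: "continuous_on UNIV (\<lambda>t. group t x)"
proof -
  have "isCont (\<lambda>t. group t x) t" for t
  proof -
    \<comment> \<open>Again \<open>t\<close> becomes an interior point, so continuity on the
      interval gives continuity at \<open>t\<close>.\<close>
    define r where "r = \<bar>t\<bar> + 1"
    have "continuous_on {-r..r} (\<lambda>t. group t x)"
    proof (rule uniform_limit_theorem[OF _ group_uniform_limit])
      have "continuous_on UNIV (\<lambda>t. exp_op (approx n) t x)" for n
        using bounded_skew.derivative[OF approx_skew, of n x]
        by (intro continuous_at_imp_continuous_on ballI has_vector_derivative_continuous)
      then show "\<forall>\<^sub>F n in sequentially. continuous_on {-r..r} (\<lambda>t. exp_op (approx n) t x)"
        by (intro always_eventually allI) (rule continuous_on_subset, auto)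
    qed simp
    then show ?thesis
      by (rule continuous_on_interior) (auto simp: r_def)
  qed
  then show ?thesis
    by (simp add: continuous_at_imp_continuous_on)
qed

lemma unitary_group: "unitary_group group"
proof -
  have "range (group t) = UNIV" for t
    using group_add[of t "- t"] group_0 by (metis add.right_inverse id_apply surjI)
  then show ?thesis
    unfolding unitary_group_def
    by (auto simp: group_0 group_add group_isometry continuous_group fun_eq_iff intro!: unitary_ontoI)
qed

section \<open>Identification of the generator\<close>

lemma group_has_vector_derivative:
  assumes xy: "(x, y) \<in> B"
  shows "((\<lambda>t. group t x) has_vector_derivative y) (at 0)"
proof -
  \<comment> \<open>Limit and derivative are interchanged: the derivatives
    \<open>exp_op (approx n) t (approx n x)\<close> converge to \<open>group t y\<close> uniformly
    near 0, by isometry and the convergence of \<open>approx n x\<close> to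
    \<open>y\<close>.\<close>
  have "\<exists>g. \<forall>t\<in>{-1<..<1}. (\<lambda>n. exp_op (approx n) t x) \<longlonglongrightarrow> g t \<and>
      (g has_derivative (\<lambda>h. h *\<^sub>R group t y)) (at t within {-1<..<1})"
  proof (rule has_derivative_sequence)
    show "((\<lambda>t. exp_op (approx n) t x) has_derivative (\<lambda>h. h *\<^sub>R exp_op (approx n) t (approx n x)))
        (at t within {-1<..<1})" for n t
    proof -
      have "approx n (exp_op (approx n) t x) = exp_op (approx n) t (approx n x)"
        by (rule bounded_skew.exp_op_commute[OF approx_skew bounded_linear_approx refl])
      then show ?thesis
        using bounded_skew.derivative[OF approx_skew, of n x t]
        by (simp add: has_vector_derivative_def has_derivative_at_withinI)
    qed
  next
    fix \<epsilon> :: real assume \<epsilon>: "\<epsilon> > 0"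
    have "\<forall>\<^sub>F n in sequentially. dist (approx n x) y < \<epsilon> / 2"
      using approx_tendsto[OF xy] \<epsilon> by (intro tendstoD) auto
    moreover have "\<forall>\<^sub>F n in sequentially. \<forall>t\<in>{-1..1}. dist (exp_op (approx n) t y) (group t y) < \<epsilon> / 2"
      using group_uniform_limit \<epsilon> by (intro uniform_limitD) auto
    ultimately show "\<forall>\<^sub>F n in sequentially. \<forall>t\<in>{-1<..<1}. \<forall>h.
        norm (h *\<^sub>R exp_op (approx n) t (approx n x) - h *\<^sub>R group t y) \<le> \<epsilon> * norm h"
    proof eventually_elim
      case (elim n)
      have "norm (exp_op (approx n) t (approx n x) - group t y) \<le> \<epsilon>" if "t \<in> {-1<..<1}" for t
        using that elim(1) bspec[OF elim(2), of t] norm_exp_approx_diff[of n t "approx n x" y]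
          dist_triangle[of "exp_op (approx n) t (approx n x)" "group t y" "exp_op (approx n) t y"]
        by (simp add: dist_norm)
      then show ?case
        by (auto simp: mult.commute[of \<epsilon>] simp flip: scaleR_diff_right intro!: mult_left_mono)
    qed
  next
    show "(0::real) \<in> {-1<..<1}"
      by simp
  qed (rule convex_real_interval group_tendsto)+
  then obtain g where g: "\<And>t. t \<in> {-1<..<1} \<Longrightarrow> (\<lambda>n. exp_op (approx n) t x) \<longlonglongrightarrow> g t"
    and g': "\<And>t. t \<in> {-1<..<1} \<Longrightarrow> (g has_derivative (\<lambda>h. h *\<^sub>R group t y)) (at t within {-1<..<1})"
    by blast
  have 0: "(0::real) \<in> {-1<..<1}"
    by simp
  have "((\<lambda>t. group t x) has_derivative (\<lambda>h. h *\<^sub>R group 0 y)) (at 0 within {-1<..<1})"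
    by (rule has_derivative_transform[OF 0 _ g'[OF 0]]) (rule LIMSEQ_unique[OF group_tendsto g])
  then show ?thesis
    unfolding has_vector_derivative_def at_within_open[OF 0 open_greaterThanLessThan]
    by (simp add: group_0)
qed

text \<open>The graph of \<open>B\<close> lies in the generator by differentiability. Conversely,
  differentiating the constant scalar product of two orbits at 0 shows that any pair in the
  generator passes the test \<open>mem_iff\<close>, so nothing larger than \<open>B\<close> can
  occur.\<close>

theorem generates_unitary_group: "generates_unitary_group B"
proof -
  have "(x', y') \<in> B" if "(x', y') \<in> generator group" for x' y'
  proof (rule memI)
    fix x y assume "(x, y) \<in> B"
    then have "((\<lambda>t. cinner (group t x) (group t x')) has_vector_derivative
        cinner (group 0 x) y' + cinner y (group 0 x')) (at 0)"
      using that group_has_vector_derivative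
      by (intro cinner_has_vector_derivative) (auto simp: generator_def)
    then have "((\<lambda>t. cinner x x') has_vector_derivative cinner x y' + cinner y x') (at 0)"
      by (simp add: group_isometry group_0)
    from vector_derivative_unique_at[OF this has_vector_derivative_const]
    show "cinner y x' = - cinner x y'"
      by (simp add: add_eq_0_iff)
  qed
  then have "generator group = B"
    using group_has_vector_derivative by (auto simp: generator_def)
  then show ?thesis
    using unitary_group unfolding generates_unitary_group_def by blast
qed

lemma self_adjoint: "self_adjoint (scale_op \<i> B)"
proof -
  have mem: "(x, y) \<in> scale_op \<i> B \<longleftrightarrow> (x, - (\<i> *\<^sub>C y)) \<in> B" for x y
  proof -
    have "y = \<i> *\<^sub>C z \<longleftrightarrow> z = - (\<i> *\<^sub>C y)" for z
      by (auto simp: scaleC_scaleC scaleC_one)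
    then show ?thesis
      by (auto simp: scale_op_def)
  qed
  have "linear_operator (scale_op \<i> B)"
    unfolding linear_operator_def single_valued_def
  proof (intro conjI allI impI complex_vector.subspaceI)
    show "c *\<^sub>C p \<in> scale_op \<i> B" if "p \<in> scale_op \<i> B" for c p
      using that scaleC[of "fst p" "- (\<i> *\<^sub>C snd p)" c] mem[of "fst p" "snd p"]
      by (simp add: mem scaleC_prod_def scaleC_scaleC mult.commute)
    show "p + q \<in> scale_op \<i> B" if "p \<in> scale_op \<i> B" "q \<in> scale_op \<i> B" for p q
    proof -
      have "(fst p + fst q, - (\<i> *\<^sub>C snd p) + - (\<i> *\<^sub>C snd q)) \<in> B"
        by (intro add mem[THEN iffD1]) (simp_all add: that)
      then have "(fst p + fst q, snd p + snd q) \<in> scale_op \<i> B"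
        by (simp add: mem scaleC_add_right)
      then show ?thesis
        by (simp add: plus_prod_def)
    qed
    show "y = y'" if "(x, y) \<in> scale_op \<i> B" "(x, y') \<in> scale_op \<i> B" for x y y'
      using unique that unfolding scale_op_def by blast
  qed (simp add: mem zero zero_prod_def)
  moreover have "Domain (scale_op \<i> B) = Domain B"
    by (auto simp: scale_op_def)
  then have "densely_defined (scale_op \<i> B)"
    by (simp add: densely_defined_def dense)
  moreover have "(g, h) \<in> adjoint_op (scale_op \<i> B) \<longleftrightarrow> (g, h) \<in> scale_op \<i> B" for g h
  proof -
    have "(g, h) \<in> adjoint_op (scale_op \<i> B) \<longleftrightarrow> (\<forall>(x, y)\<in>B. cinner (\<i> *\<^sub>C y) g = cinner x h)"
      unfolding adjoint_op_def scale_op_def by blast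
    also have "\<dots> \<longleftrightarrow> (\<forall>(x, y)\<in>B. cinner y g = - cinner x (- (\<i> *\<^sub>C h)))"
    proof -
      \<comment> \<open>The factor \<open>- \<i>\<close> is the conjugate of \<open>\<i>\<close>,
        pulled out of the first argument; it turns the skew condition into the symmetric
        one.\<close>
      have "- \<i> * a = b \<longleftrightarrow> a = \<i> * b" for a b :: complex
        by (auto simp: complex_eq_iff)
      then show ?thesis
        by (simp add: cinner_scaleC_left cinner_scaleC_right)
    qed
    also have "\<dots> \<longleftrightarrow> (g, h) \<in> scale_op \<i> B"
      unfolding mem mem_iff ..
    finally show ?thesis .
  qed
  then have "adjoint_op (scale_op \<i> B) = scale_op \<i> B"
    by (simp add: set_eq_iff split_paired_all)
  ultimately show ?thesis
    by (simp add: self_adjoint_def)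
qed

end

section \<open>Adjoints\<close>

lemma adjoint_opI: "(\<And>f u. (f, u) \<in> T \<Longrightarrow> cinner u g = cinner f k) \<Longrightarrow> (g, k) \<in> adjoint_op T"
  by (auto simp: adjoint_op_def)

lemma adjoint_opD: "(g, k) \<in> adjoint_op T \<Longrightarrow> (f, u) \<in> T \<Longrightarrow> cinner u g = cinner f k"
  by (auto simp: adjoint_op_def)

lemma adjoint_op_add:
  "(g, k) \<in> adjoint_op T \<Longrightarrow> (g', k') \<in> adjoint_op T \<Longrightarrow> (g + g', k + k') \<in> adjoint_op T"
  by (rule adjoint_opI) (simp add: cinner_add_right adjoint_opD[where T = T])

lemma adjoint_op_scaleC:
  "(g, k) \<in> adjoint_op T \<Longrightarrow> (c *\<^sub>C g, c *\<^sub>C k) \<in> adjoint_op T"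
  by (rule adjoint_opI) (simp add: cinner_scaleC_right adjoint_opD[where T = T])

lemma adjoint_op_scaleC_iff:
  assumes "c \<noteq> 0"
  shows "(c *\<^sub>C g, c *\<^sub>C k) \<in> adjoint_op T \<longleftrightarrow> (g, k) \<in> adjoint_op T"
  using adjoint_op_scaleC[of g k T c] adjoint_op_scaleC[of "c *\<^sub>C g" "c *\<^sub>C k" T "inverse c"] assms
  by (auto simp: scaleC_scaleC scaleC_one)

lemma adjoint_op_zero: "(0, 0) \<in> adjoint_op T"
  by (rule adjoint_opI) simp

lemma adjoint_op_unique:
  assumes "densely_defined T" and "(g, k) \<in> adjoint_op T" and "(g, k') \<in> adjoint_op T"
  shows "k = k'"
proof -
  have "cinner f (k - k') = 0" if f: "f \<in> Domain T" for f
  proof -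
    obtain u where u: "(f, u) \<in> T"
      using f by blast
    show ?thesis
      using adjoint_opD[OF assms(2) u] adjoint_opD[OF assms(3) u] by (simp add: cinner_diff_right)
  qed
  moreover have "k - k' \<in> closure (Domain T)"
    using assms(1) unfolding densely_defined_def by blast
  ultimately have "cinner (k - k') (k - k') = 0"
    by (rule cinner_eq_0_on_closure)
  then show ?thesis
    by (simp add: cinner_self_eq_0)
qed

text \<open>The component of \<open>(f, u)\<close> orthogonal to the graph of \<open>T\<close> is \<open>(- k, g)\<close> with \<open>(g, k)\<close> in
  the graph of the adjoint.\<close>

lemma mem_if_biadjoint:
  fixes T :: "('a::chilbert_space, 'b::chilbert_space) operator"
  assumes T: "linear_operator T" "closed T"
    and adj: "\<And>g k. (g, k) \<in> adjoint_op T \<Longrightarrow> cinner k f = cinner g u"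
  shows "(f, u) \<in> T"
proof -
  have "complex_vector.subspace T"
    using T(1) by (simp add: linear_operator_def)
  then obtain m where m: "m \<in> T" "\<And>p. p \<in> T \<Longrightarrow> cinner p ((f, u) - m) = 0"
    using orthogonal_decomposition[OF _ T(2)] by metis
  obtain f0 u0 where m_eq: "m = (f0, u0)"
    by fastforce
  have "(u - u0, - (f - f0)) \<in> adjoint_op T"
  proof (rule adjoint_opI)
    fix x y assume "(x, y) \<in> T"
    from m(2)[OF this] show "cinner y (u - u0) = cinner x (- (f - f0))"
      by (simp add: m_eq cinner_prod_def add_eq_0_iff del: minus_diff_eq)
  qed
  from adj[OF this] have "cinner ((f, u) - m) (f, u) = 0"
    by (simp add: m_eq cinner_prod_def add_eq_0_iff del: minus_diff_eq)
  moreover have "cinner ((f, u) - m) m = 0"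
    using m by (metis cinner_commute complex_cnj_zero)
  ultimately have "cinner ((f, u) - m) ((f, u) - m) = 0"
    by (simp add: cinner_diff_right[of _ "(f, u)" m])
  then show ?thesis
    using m(1) by (simp add: cinner_self_eq_0)
qed

section \<open>The energy space\<close>

locale energy_operator =
  fixes A :: "('a::chilbert_space, 'b::chilbert_space) operator"
    and e :: "'a \<Rightarrow> 'h::chilbert_space"
  assumes linear: "linear_operator A" and densely_defined: "densely_defined A" and closed: "closed A"
    and ker: "ker A = {0}" and completion: "energy_completion A e"
begin

lemma unique: "(f, u) \<in> A \<Longrightarrow> (f, v) \<in> A \<Longrightarrow> u = v"
  using linear by (auto simp: linear_operator_def single_valued_def)

lemma subspace: "complex_vector.subspace A"
  using linear by (simp add: linear_operator_def)

lemma zero: "(0, 0) \<in> A"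
  using complex_vector.subspace_0[OF subspace] by (simp add: zero_prod_def)

lemma add: "(f, u) \<in> A \<Longrightarrow> (g, v) \<in> A \<Longrightarrow> (f + g, u + v) \<in> A"
  using complex_vector.subspace_add[OF subspace] by fastforce

lemma scaleC: "(f, u) \<in> A \<Longrightarrow> (c *\<^sub>C f, c *\<^sub>C u) \<in> A"
  using complex_vector.subspace_scale[OF subspace, of "(f, u)" c] by (simp add: scaleC_prod_def)

section \<open>The unitary extension of \<open>A\<close> to the energy space\<close>

lemma cinner_embed: "(f, u) \<in> A \<Longrightarrow> (g, v) \<in> A \<Longrightarrow> cinner (e f) (e g) = cinner u v"
  using completion unfolding energy_completion_def by fast

lemma closure_embed: "closure (e ` Domain A) = UNIV"
  using completion by (simp add: energy_completion_def)

text \<open>Distances of values of \<open>A\<close> and of embedded arguments agree, which makes the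
  map from \<open>e f\<close> to the value at \<open>f\<close> well defined and lets Cauchy
  sequences pass between range and energy space.\<close>

lemma dist_embed:
  assumes "(f, u) \<in> A" and "(g, v) \<in> A"
  shows "dist u v = dist (e f) (e g)"
proof -
  have "(dist u v)\<^sup>2 = (dist (e f) (e g))\<^sup>2"
    using cinner_embed[OF assms] cinner_embed[OF assms(2,1)]
      cinner_embed[OF assms(1,1)] cinner_embed[OF assms(2,2)]
    by (simp add: dist_norm norm_sq_cinner cinner_simps)
  then show ?thesis
    by simp
qed

text \<open>An isometry on a dense set is uniformly continuous, hence extends continuously into the
  complete target.\<close>

lemma cinner_preserving_extension_exists:
  "\<exists>V. (\<forall>x y. cinner (V x) (V y) = cinner x y) \<and> (\<forall>(f, u)\<in>A. V (e f) = u)"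
proof -
  define X where "X = e ` Domain A"
  \<comment> \<open>A choice of preimage under \<open>e\<close>; \<open>dist_embed\<close> shows
    that the resulting value is independent of it.\<close>
  define V0 where "V0 h = (SOME u. \<exists>f. h = e f \<and> (f, u) \<in> A)" for h
  have V0: "V0 (e f) = u" if fu: "(f, u) \<in> A" for f u
  proof -
    have "\<exists>g. e f = e g \<and> (g, V0 (e f)) \<in> A"
      unfolding V0_def by (rule someI[of "\<lambda>u. \<exists>g. e f = e g \<and> (g, u) \<in> A" u]) (use fu in blast)
    then obtain g where "e f = e g" "(g, V0 (e f)) \<in> A"
      by blast
    then show ?thesis
      using dist_embed[of g "V0 (e f)" f u] fu by simp
  qed
  have "uniformly_continuous_on X V0"
    unfolding uniformly_continuous_on_def X_def
  proof (intro allI impI)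
    fix \<epsilon> :: real assume "\<epsilon> > 0"
    then show "\<exists>d>0. \<forall>x\<in>e ` Domain A. \<forall>x'\<in>e ` Domain A. dist x' x < d \<longrightarrow> dist (V0 x') (V0 x) < \<epsilon>"
      by (intro exI[of _ \<epsilon>]) (auto simp: V0 dist_embed)
  qed
  then obtain V where V: "uniformly_continuous_on (closure X) V" "\<And>x. x \<in> X \<Longrightarrow> V0 x = V x"
    using uniformly_continuous_on_extension_on_closure by metis
  have X: "closure X = UNIV"
    by (simp add: X_def closure_embed)
  have cont: "continuous_on UNIV V"
    using uniformly_continuous_imp_continuous[OF V(1)] by (simp add: X)
  have Ve: "V (e f) = u" if "(f, u) \<in> A" for f u
    using V(2)[of "e f"] V0[OF that] imageI[OF DomainI[OF that], of e] by (simp add: X_def)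
  have 1: "cinner (V x) (V y) = cinner x y" if "x \<in> X" "y \<in> X" for x y
    using that by (auto simp: X_def Ve cinner_embed)
  \<comment> \<open>The identity passes from the dense set to the whole space one argument at a
    time.\<close>
  have 2: "cinner (V x) (V y) - cinner x y = 0" if x: "x \<in> X" for x y
    by (rule continuous_constant_on_closure[of X "\<lambda>y. cinner (V x) (V y) - cinner x y"])
      (use 1[OF x] cont X in \<open>auto intro!: continuous_intros cinner.continuous_on\<close>)
  have 3: "cinner (V x) (V y) - cinner x y = 0" for x y
    by (rule continuous_constant_on_closure[of X "\<lambda>x. cinner (V x) (V y) - cinner x y"])
      (use 2 cont X in \<open>auto intro!: continuous_intros cinner.continuous_on\<close>)
  then show ?thesis
    using Ve by (intro exI[of _ V]) auto
qed

text \<open>Continuity keeps the range inside the closure of \<open>Range A\<close>. For the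
  converse, preimages of a convergent sequence in \<open>Range A\<close> form a Cauchy sequence in
  the energy space, whose completeness supplies a limit mapped to the given vector.\<close>

lemma range_extension:
  assumes V: "\<And>x y. cinner (V x) (V y) = cinner x y" and Ve: "\<And>f u. (f, u) \<in> A \<Longrightarrow> V (e f) = u"
  shows "range V = K_space A"
proof
  have "continuous_on (closure (e ` Domain A)) V"
    using dist_if_cinner_preserving[OF V] by (auto simp: continuous_on_iff)
  moreover have "V ` e ` Domain A \<subseteq> closure (Range A)"
    using Ve closure_subset[of "Range A"] by (auto simp: Domain_iff)
  ultimately have "V ` closure (e ` Domain A) \<subseteq> closure (Range A)"
    by (intro image_closure_subset closed_closure)
  then show "range V \<subseteq> K_space A"
    by (simp add: closure_embed K_space_def)
next
  show "K_space A \<subseteq> range V"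
  proof
    fix v assume "v \<in> K_space A"
    then obtain u where u: "\<And>n. u n \<in> Range A" "u \<longlonglongrightarrow> v"
      by (auto simp: K_space_def closure_sequential)
    then have "\<forall>n. \<exists>f. (f, u n) \<in> A"
      by blast
    then obtain f where f: "\<And>n. (f n, u n) \<in> A"
      by metis
    have "Cauchy (\<lambda>n. e (f n))"
      using LIMSEQ_imp_Cauchy[OF u(2)] by (simp add: Cauchy_def dist_embed[OF f f])
    then obtain h where "(\<lambda>n. e (f n)) \<longlonglongrightarrow> h"
      by (auto simp: Cauchy_convergent_iff convergent_def)
    then have "(\<lambda>n. V (e (f n))) \<longlonglongrightarrow> V h"
      using dist_if_cinner_preserving[OF V] by (simp add: lim_sequentially)
    then show "v \<in> range V"
      using LIMSEQ_unique u(2) by (auto simp: Ve[OF f])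
  qed
qed

lemma extension_unique:
  assumes V: "\<And>x y. cinner (V x) (V y) = cinner x y" "\<And>f u. (f, u) \<in> A \<Longrightarrow> V (e f) = u"
    and W: "\<And>x y. cinner (W x) (W y) = cinner x y" "\<And>f u. (f, u) \<in> A \<Longrightarrow> W (e f) = u"
  shows "V = W"
proof
  fix h
  have "V h - W h = 0"
  proof (rule continuous_constant_on_closure[of "e ` Domain A" "\<lambda>h. V h - W h"])
    show "continuous_on (closure (e ` Domain A)) (\<lambda>h. V h - W h)"
      using dist_if_cinner_preserving[OF V(1)] dist_if_cinner_preserving[OF W(1)]
      by (intro continuous_on_diff) (auto simp: continuous_on_iff)
    show "V h - W h = 0" if "h \<in> e ` Domain A" for h
    proof -
      obtain f u where "(f, u) \<in> A" "h = e f"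
        using \<open>h \<in> e ` Domain A\<close> by blast
      then show ?thesis
        by (simp add: V(2) W(2))
    qed
  qed (simp add: closure_embed)
  then show "V h = W h"
    by simp
qed

abbreviation V :: "'h \<Rightarrow> 'b" where
  "V \<equiv> A_tilde A e"

lemma V_unitary: "unitary_onto V (K_space A)" and V_embed_all: "\<forall>(f, u)\<in>A. V (e f) = u"
proof -
  obtain V0 where V0_cinner: "\<forall>x y. cinner (V0 x) (V0 y) = cinner x y"
    and V0_embed: "\<forall>(f, u)\<in>A. V0 (e f) = u"
    using cinner_preserving_extension_exists by (elim exE conjE)
  have V0: "cinner (V0 x) (V0 y) = cinner x y" "(f, u) \<in> A \<Longrightarrow> V0 (e f) = u" for x y f u
    using V0_cinner V0_embed by auto
  have "range V0 = K_space A"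
    by (rule range_extension) (rule V0(1), erule V0(2))
  then have "unitary_onto V0 (K_space A)"
    by (intro unitary_ontoI V0(1))
  with V0_embed have P: "unitary_onto V0 (K_space A) \<and> (\<forall>(f, u)\<in>A. V0 (e f) = u)"
    by (intro conjI)
  \<comment> \<open>Existence and uniqueness of the extension justify the definite description in
    \<open>A_tilde\<close>.\<close>
  have "A_tilde A e = V0"
    unfolding A_tilde_def
  proof (rule the_equality)
    show "unitary_onto V0 (K_space A) \<and> (\<forall>(f, u)\<in>A. V0 (e f) = u)"
      by (rule P)
    fix W assume W: "unitary_onto W (K_space A) \<and> (\<forall>(f, u)\<in>A. W (e f) = u)"
    show "W = V0"
    proof (rule extension_unique)
      show "cinner (W x) (W y) = cinner x y" for x y
        using W by (simp add: unitary_onto_def)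
      show "W (e f) = u" if "(f, u) \<in> A" for f u
        using W that by auto
    qed (rule V0(1), erule V0(2))
  qed
  then show "unitary_onto V (K_space A)" "\<forall>(f, u)\<in>A. V (e f) = u"
    using P by simp_all
qed

lemma V_embed: "(f, u) \<in> A \<Longrightarrow> V (e f) = u"
  using V_embed_all by auto

lemma V_cinner [simp]: "cinner (V x) (V y) = cinner x y"
  using V_unitary by (simp add: unitary_onto_def)

lemma range_V: "range V = K_space A"
  using V_unitary by (simp add: unitary_onto_def)

lemma V_add: "V (x + y) = V x + V y" and V_scaleC: "V (c *\<^sub>C x) = c *\<^sub>C V x"
  using V_unitary by (auto simp: unitary_onto_def Vector_Spaces.linear_iff)

lemma V_zero [simp]: "V 0 = 0"
  using V_add[of 0 0] by simp

lemma V_minus [simp]: "V (- x) = - V x"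
  using V_scaleC[of "- 1" x] by (simp add: scaleC_one)

lemma V_eq_iff [simp]: "V x = V y \<longleftrightarrow> x = y"
proof -
  have "dist (V x) (V y) = dist x y"
    by (rule dist_if_cinner_preserving) (rule V_cinner)
  then show ?thesis
    by auto
qed

section \<open>The graph of \<open>G_op A e\<close> and its skew-adjointness\<close>

lemma G_op_mem:
  "((h, f), (p, q)) \<in> G_op A e \<longleftrightarrow> (f, V p) \<in> A \<and> (V h, - q) \<in> adjoint_op A"
proof -
  \<comment> \<open>Injectivity of \<open>V\<close> turns the embedding condition into membership in
    the graph of \<open>A\<close>, so that only graphs of \<open>A\<close> and its adjoint
    remain.\<close>
  have "f \<in> Domain A \<and> p = e f \<longleftrightarrow> (f, V p) \<in> A"
  proof
    show "(f, V p) \<in> A" if "f \<in> Domain A \<and> p = e f"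
      using that V_embed by auto
    show "f \<in> Domain A \<and> p = e f" if "(f, V p) \<in> A"
      using that V_embed[OF that] V_eq_iff[of "e f" p] by auto
  qed
  then show ?thesis
    unfolding G_op_def J_op_def fun_op_def relcomp_unfold by force
qed

lemma cinner_K_ker_adjoint:
  assumes "(g, 0) \<in> adjoint_op A" and "v \<in> K_space A"
  shows "cinner v g = 0"
proof (rule cinner_eq_0_on_closure)
  show "v \<in> closure (Range A)"
    using assms(2) by (simp add: K_space_def)
qed (use adjoint_opD[OF assms(1)] in auto)

text \<open>Projecting \<open>g\<close> onto \<open>K_space A\<close> removes a vector orthogonal to
  \<open>Range A\<close>, on which the adjoint vanishes, so the projection keeps the value
  \<open>k\<close>. The vector \<open>h\<close> is the projection in energy coordinates.\<close>

lemma adjoint_decomposition: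
  assumes gk: "(g, k) \<in> adjoint_op A"
  obtains h where "(V h, k) \<in> adjoint_op A" and "\<And>x. cinner (V x) g = cinner x h"
proof -
  have "complex_vector.subspace (Range A)"
    by (rule complex_vector.subspaceI) (use zero add scaleC in blast)+
  then obtain v where v: "v \<in> K_space A" "\<And>w. w \<in> K_space A \<Longrightarrow> cinner w (g - v) = 0"
    using orthogonal_decomposition[OF closure_complex_subspace closed_closure]
    unfolding K_space_def by metis
  obtain h where h: "v = V h"
    using v(1) range_V by blast
  have "cinner (V x) g = cinner x h" for x
    using v(2)[of "V x"] range_V by (auto simp: h cinner_diff_right)
  moreover have "(V h, k) \<in> adjoint_op A"
  proof (rule adjoint_opI)
    fix f u assume fu: "(f, u) \<in> A"
    then have "u \<in> K_space A"
      using closure_subset unfolding K_space_def by fast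
    then show "cinner u (V h) = cinner f k"
      using v(2)[of u] adjoint_opD[OF gk fu] by (simp add: h cinner_diff_right)
  qed
  ultimately show ?thesis
    using that by blast
qed

lemma skew_adjoint_G_op: "skew_adjoint (G_op A e)"
proof
  show "linear_operator (G_op A e)"
    unfolding linear_operator_def
  proof (intro conjI complex_vector.subspaceI)
    show "0 \<in> G_op A e"
      by (simp add: zero_prod_def G_op_mem zero adjoint_op_zero)
    show "x + y \<in> G_op A e" if "x \<in> G_op A e" "y \<in> G_op A e" for x y
    proof -
      obtain h f p q h' f' p' q' where "x = ((h, f), (p, q))" "y = ((h', f'), (p', q'))"
        by (metis surj_pair)
      then show ?thesis
        using that add[of f "V p" f' "V p'"] adjoint_op_add[of "V h" "- q" A "V h'" "- q'"]
        by (simp add: G_op_mem V_add)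
    qed
    show "c *\<^sub>C x \<in> G_op A e" if "x \<in> G_op A e" for c x
    proof -
      obtain h f p q where "x = ((h, f), (p, q))"
        by (metis surj_pair)
      then show ?thesis
        using that scaleC[of f "V p" c] adjoint_op_scaleC[of "V h" "- q" A c]
        by (simp add: G_op_mem V_scaleC scaleC_prod_def)
    qed
    show "single_valued (G_op A e)"
    proof (rule single_valuedI)
      fix x y z assume xy: "(x, y) \<in> G_op A e" and xz: "(x, z) \<in> G_op A e"
      obtain h f p q p' q' where eq: "x = (h, f)" "y = (p, q)" "z = (p', q')"
        by (metis surj_pair)
      then have "V p = V p'" and "- q = - q'"
        using xy xz unique[of f] adjoint_op_unique[OF densely_defined, of "V h"]
        by (simp_all only: G_op_mem)
      then show "y = z"
        by (simp add: eq)
    qed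
  qed
next
  fix x' y' :: "'h \<times> 'a"
  obtain h' f' p' q' where x': "x' = (h', f')" and y': "y' = (p', q')"
    by fastforce
  show "(x', y') \<in> G_op A e \<longleftrightarrow> (\<forall>(x, y)\<in>G_op A e. cinner y x' = - cinner x y')"
  proof
    assume "(x', y') \<in> G_op A e"
    then have 1: "(f', V p') \<in> A" "(V h', - q') \<in> adjoint_op A"
      by (simp_all add: x' y' G_op_mem)
    have "cinner p h' + cinner q f' = - (cinner h p' + cinner f q')"
      if 2: "(f, V p) \<in> A" "(V h, - q) \<in> adjoint_op A" for h f p q
    proof -
      have "cinner p h' = - cinner f q'"
        using adjoint_opD[OF 1(2) 2(1)] by simp
      moreover have "cinner p' h = - cinner f' q"
        using adjoint_opD[OF 2(2) 1(1)] by simp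
      then have "cinner h p' = - cinner q f'"
        by (metis cinner_commute complex_cnj_minus)
      ultimately show ?thesis
        by simp
    qed
    then show "\<forall>(x, y)\<in>G_op A e. cinner y x' = - cinner x y'"
      by (simp add: x' y' G_op_mem cinner_prod_def split_paired_Ball_Sigma split_paired_all Ball_def)
  next
    assume adj': "\<forall>(x, y)\<in>G_op A e. cinner y x' = - cinner x y'"
    have adj: "cinner p h' + cinner q f' = - (cinner h p' + cinner f q')"
      if "(f, V p) \<in> A" "(V h, - q) \<in> adjoint_op A" for h f p q
    proof -
      have "((h, f), (p, q)) \<in> G_op A e"
        using that by (simp add: G_op_mem)
      with adj' have "cinner (p, q) x' = - cinner (h, f) y'"
        by blast
      then show ?thesis
        by (simp add: x' y' cinner_prod_def)
    qed
    have "(V h', - q') \<in> adjoint_op A"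
    proof (rule adjoint_opI)
      fix f u assume fu: "(f, u) \<in> A"
      then have "(f, V (e f)) \<in> A"
        by (simp add: V_embed)
      \<comment> \<open>Test pairs with \<open>h = 0\<close> and \<open>q = 0\<close> isolate the
        condition that defines the adjoint of \<open>A\<close>.\<close>
      from adj[OF this, of 0 0] show "cinner u (V h') = cinner f (- q')"
        by (simp add: adjoint_op_zero flip: V_embed[OF fu])
    qed
    moreover have "(f', V p') \<in> A"
    proof (rule mem_if_biadjoint[OF linear closed])
      \<comment> \<open>Test pairs of \<open>G_op A e\<close> only reach vectors \<open>V h\<close>,
        whereas the biadjoint test runs over all \<open>g\<close>; the decomposition bridges the
        gap.\<close>
      fix g k assume "(g, k) \<in> adjoint_op A"
      then obtain h where h: "(V h, k) \<in> adjoint_op A" "\<And>x. cinner (V x) g = cinner x h"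
        using adjoint_decomposition by metis
      from adj[of 0 0 h "- k"] have "cinner k f' = cinner h p'"
        using h(1) zero by simp
      also have "\<dots> = cinner g (V p')"
        using h(2)[of p'] by (metis cinner_commute)
      finally show "cinner k f' = cinner g (V p')" .
    qed
    ultimately show "(x', y') \<in> G_op A e"
      by (simp add: x' y' G_op_mem)
  qed
qed

section \<open>The intertwining identity\<close>

lemma orth_proj_ker_Q_op:
  assumes "x \<in> UNIV \<times> K_space A"
  shows "orth_proj (ker (Q_op A)) x = 0"
proof -
  let ?N = "ker (Q_op A)"
  \<comment> \<open>Injectivity of \<open>A\<close> reduces the kernel to \<open>{0}\<close> times
    the kernel of the adjoint, and the latter is orthogonal to \<open>K_space A\<close>.\<close>
  have N: "z \<in> ?N \<longleftrightarrow> fst z = 0 \<and> (snd z, 0) \<in> adjoint_op A" for z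
    using ker by (cases z) (auto simp: ker_def Q_op_def zero_prod_def)
  have orth: "cinner z x = 0" if "z \<in> ?N" for z
    using that cinner_K_ker_adjoint[of "snd z" "snd x"] assms
      cinner_commute[of "snd z" "snd x"] by (auto simp: N cinner_prod_def)
  show ?thesis
    unfolding orth_proj_def
  proof (rule the_equality)
    show "0 \<in> ?N \<and> (\<forall>z\<in>?N. cinner z (x - 0) = 0)"
      using orth by (simp add: N adjoint_op_zero)
    fix y assume y: "y \<in> ?N \<and> (\<forall>z\<in>?N. cinner z (x - y) = 0)"
    then have "cinner y (x - y) = 0"
      by blast
    then have "cinner y y = 0"
      using orth y by (simp add: cinner_diff_right)
    then show "y = 0"
      by (simp add: cinner_self_eq_0)
  qed
qed

lemma part_Q_op_eq:
  "part_in (UNIV \<times> K_space A) (Q_op A \<circ>\<^sub>o fun_op (\<lambda>x. x - orth_proj (ker (Q_op A)) x))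
    = fun_op (U_tilde A e) \<circ>\<^sub>o scale_op \<i> (G_op A e) \<circ>\<^sub>o (fun_op (U_tilde A e))\<inverse>"
    (is "?L = ?R")
proof -
  have L: "((f, g), (k, u)) \<in> ?L \<longleftrightarrow> g \<in> K_space A \<and> (f, u) \<in> A \<and> (g, k) \<in> adjoint_op A" for f g k u
  proof -
    have "((f, g), (k, u)) \<in> ?L \<longleftrightarrow> g \<in> K_space A \<and> u \<in> K_space A \<and>
        ((f, g) - orth_proj (ker (Q_op A)) (f, g), (k, u)) \<in> Q_op A"
      unfolding part_in_def fun_op_def relcomp_unfold
      by (simp del: split_paired_Ex) blast
    also have "\<dots> \<longleftrightarrow> g \<in> K_space A \<and> u \<in> K_space A \<and> (f, u) \<in> A \<and> (g, k) \<in> adjoint_op A"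
      using orth_proj_ker_Q_op[of "(f, g)"] by (auto simp: Q_op_def)
    \<comment> \<open>The condition on \<open>u\<close> is automatic, as \<open>u\<close> lies in
      \<open>Range A\<close>.\<close>
    also have "\<dots> \<longleftrightarrow> g \<in> K_space A \<and> (f, u) \<in> A \<and> (g, k) \<in> adjoint_op A"
      using closure_subset unfolding K_space_def by fast
    finally show ?thesis .
  qed
  have R: "((f, g), (k, u)) \<in> ?R \<longleftrightarrow> g \<in> K_space A \<and> (f, u) \<in> A \<and> (g, k) \<in> adjoint_op A" for f g k u
  proof -
    have "((f, g), (k, u)) \<in> ?R \<longleftrightarrow> (\<exists>h p q. g = - (\<i> *\<^sub>C V h) \<and> ((h, f), (p, q)) \<in> G_op A e \<and>
        k = \<i> *\<^sub>C q \<and> u = - (\<i> *\<^sub>C V (\<i> *\<^sub>C p)))"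
      unfolding fun_op_def scale_op_def U_tilde_def relcomp_unfold
      by (auto simp: scaleC_prod_def)
    also have "\<dots> \<longleftrightarrow> (\<exists>h p q. g = V (- \<i> *\<^sub>C h) \<and> (f, V p) \<in> A \<and> (V h, - q) \<in> adjoint_op A \<and>
        k = \<i> *\<^sub>C q \<and> u = V p)"
      by (simp add: G_op_mem V_scaleC scaleC_scaleC scaleC_one)
    \<comment> \<open>Given \<open>(f, u)\<close> in \<open>A\<close>, the witness is
      \<open>p = e f\<close>.\<close>
    also have "\<dots> \<longleftrightarrow> (\<exists>h q. g = V (- \<i> *\<^sub>C h) \<and> (f, u) \<in> A \<and> (V h, - q) \<in> adjoint_op A \<and> k = \<i> *\<^sub>C q)"
      using V_embed by (metis Domain.DomainI)
    also have "\<dots> \<longleftrightarrow> (\<exists>h. g = V (- \<i> *\<^sub>C h) \<and> (f, u) \<in> A \<and> (V (- \<i> *\<^sub>C h), k) \<in> adjoint_op A)"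
    proof -
      \<comment> \<open>Multiplying the pair by \<open>- \<i>\<close> aligns it with
        \<open>g\<close> and \<open>k\<close>.\<close>
      have "(V h, - q) \<in> adjoint_op A \<longleftrightarrow> (V (- \<i> *\<^sub>C h), \<i> *\<^sub>C q) \<in> adjoint_op A" for h q
        using adjoint_op_scaleC_iff[of "- \<i>" "V h" "- q" A] by (simp add: V_scaleC)
      moreover have "k = \<i> *\<^sub>C (- \<i> *\<^sub>C k)"
        by (simp add: scaleC_scaleC scaleC_one)
      ultimately show ?thesis
        by metis
    qed
    also have "\<dots> \<longleftrightarrow> g \<in> K_space A \<and> (f, u) \<in> A \<and> (g, k) \<in> adjoint_op A"
    proof -
      have "h = - \<i> *\<^sub>C (\<i> *\<^sub>C h)" for h :: 'h
        by (simp add: scaleC_scaleC scaleC_one)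
      then have "(\<exists>h. g = V (- \<i> *\<^sub>C h)) \<longleftrightarrow> g \<in> range V"
        by (metis rangeE rangeI)
      then show ?thesis
        using range_V by blast
    qed
    finally show ?thesis .
  qed
  show ?thesis
    by (simp add: set_eq_iff split_paired_all L R)
qed

section \<open>Unitary equivalence of \<open>G_op A e\<close> and its negative\<close>

lemma G_op_unitarily_equivalent_uminus:
  "unitarily_equivalent (G_op A e) (scale_op (- 1) (G_op A e))"
proof -
  \<comment> \<open>Changing the sign of one summand flips both off-diagonal entries. As an
    involution, \<open>W\<close> is surjective and serves as its own inverse in the
    conjugation.\<close>
  define W :: "'h \<times> 'a \<Rightarrow> 'h \<times> 'a" where "W = (\<lambda>(h, f). (h, - f))"
  have W: "W (W x) = x" for x
    by (cases x) (simp add: W_def)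
  have "unitary_onto W UNIV"
    using surjI[of W W] W by (intro unitary_ontoI) (auto simp: W_def cinner_prod_def)
  moreover have "(x, y) \<in> scale_op (- 1) (G_op A e) \<longleftrightarrow>
      (x, y) \<in> fun_op W \<circ>\<^sub>o G_op A e \<circ>\<^sub>o (fun_op W)\<inverse>" for x y
  proof -
    have neg: "(- f, u) \<in> A \<longleftrightarrow> (f, - u) \<in> A" for f u
      using scaleC[of f "- u" "- 1"] scaleC[of "- f" u "- 1"] by (auto simp: scaleC_one)
    have "(x, y) \<in> scale_op (- 1) (G_op A e) \<longleftrightarrow> (x, - y) \<in> G_op A e"
    proof -
      have "(x, y) \<in> scale_op (- 1) (G_op A e) \<longleftrightarrow> (\<exists>z. y = - z \<and> (x, z) \<in> G_op A e)"
        unfolding scale_op_def by (simp add: scaleC_one del: split_paired_Ex)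
      then show ?thesis
        by (metis minus_minus)
    qed
    also have "\<dots> \<longleftrightarrow> (W x, W y) \<in> G_op A e"
      by (cases x; cases y) (simp add: W_def G_op_mem neg)
    also have "\<dots> \<longleftrightarrow> (x, y) \<in> fun_op W \<circ>\<^sub>o G_op A e \<circ>\<^sub>o (fun_op W)\<inverse>"
    proof -
      have "(x, y) \<in> fun_op W \<circ>\<^sub>o G_op A e \<circ>\<^sub>o (fun_op W)\<inverse> \<longleftrightarrow>
          (\<exists>p q. x = W p \<and> (p, q) \<in> G_op A e \<and> y = W q)"
        unfolding fun_op_def by blast
      then show ?thesis
        using W by metis
    qed
    finally show ?thesis .
  qed
  ultimately show ?thesis
    unfolding unitarily_equivalent_def by (intro exI[of _ W]) (auto simp: set_eq_iff)
qed

end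

theorem theorem3p5:
  fixes A :: "('a::chilbert_space, 'b::chilbert_space) operator"
    and e :: "'a \<Rightarrow> 'h::chilbert_space"
  assumes "separable_space (euclidean :: 'a topology)"
    and "separable_space (euclidean :: 'b topology)"
    and "linear_operator A" and "densely_defined A" and "closed A"
    and "ker A = {0}"
    and "inf_spectrum (adjoint_op A \<circ>\<^sub>o A) = 0"
    and "energy_completion A e"
  shows "part_in (UNIV \<times> K_space A)
           (Q_op A \<circ>\<^sub>o fun_op (\<lambda>x. x - orth_proj (ker (Q_op A)) x))
         = fun_op (U_tilde A e) \<circ>\<^sub>o scale_op \<i> (G_op A e) \<circ>\<^sub>o (fun_op (U_tilde A e))\<inverse>
       \<and> self_adjoint (scale_op \<i> (G_op A e))
       \<and> generates_unitary_group (G_op A e)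
       \<and> unitarily_equivalent (G_op A e) (scale_op (- 1) (G_op A e))"
proof -
  interpret energy_operator A e
    by unfold_locales fact+
  interpret G: skew_adjoint "G_op A e"
    by (rule skew_adjoint_G_op)
  show ?thesis
    using part_Q_op_eq G.self_adjoint G.generates_unitary_group G_op_unitarily_equivalent_uminus
    by blast
qed

end
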